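(* (i) Let $\ell\ge1$, $\tilde d\ge d>1$ be integers such that $m:=d^{\ell/2}$ is an integer, and let $N$ be a multiple of $\ell$ with $N\ge 3\ell$. Then the set $\mathrm{pMPS_n}(N,m,\tilde d)$ (all $N$ site dimensions equal to $\tilde d$) is not closed. (ii) More generally, let $m>1$ be an integer and suppose that the ring of $N$ sites is divided into at least three clusters $c$ of consecutive sites with lengths $\ell_c\ge 1$, $N=\sum_c\ell_c$. Suppose that the single-site Hilbert space dimensions in cluster $c$ are $\tilde d_{c,1},\dots,\tilde d_{c,\ell_c}$, and that there are positive integers $d_{c,1},\dots,d_{c,\ell_c}$ with $$\tilde d_{c,1}\ge d_{c,1},\ \dots,\ \tilde d_{c,\ell_c}\ge d_{c,\ell_c}\qquad\text{and}\qquad m^2=d_{c,1}d_{c,2}\cdots d_{c,\ell_c}$$ for every cluster $c$. Then the corresponding set $\mathrm{pMPS_n}(N,m,\{\tilde d_{c,i}\})$ is not closed.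
   Context: For site dimensions $\delta_1,\dots,\delta_N$ (listed in order around the ring), $\mathrm{pMPS_n}(N,m,\{\delta_j\})$ denotes the set of normalized heterogeneous matrix product states with periodic boundary conditions and bond dimension $m$, i.e. of all states $$|\Psi\rangle=\sum_{\sigma_1,\dots,\sigma_N}\operatorname{Tr}\!\left(A_1^{\sigma_1}A_2^{\sigma_2}\cdots A_N^{\sigma_N}\right)|\sigma_1,\dots,\sigma_N\rangle\ \in\ \bigotimes_{j=1}^N\mathbb C^{\delta_j}\quad\text{with}\quad\|\Psi\|=1,$$ where $A_j\in\mathbb C^{\delta_j\times m\times m}$ are arbitrary order-3 tensors, each regarded as a collection of $m\times m$ matrices $A_j^{1},\dots,A_j^{\delta_j}$, and $\{|\sigma_j\rangle\}$ is an orthonormal basis of $\mathbb C^{\delta_j}$. When all $\delta_j=\tilde d$, one writes $\mathrm{pMPS_n}(N,m,\tilde d)$. Closedness is with respect to the norm topology of the finite-dimensional Hilbert space. *)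

theory Defs
  imports "HOL-Analysis.Analysis" "Jordan_Normal_Form.Matrix"
begin

text \<open>
  Sites are numbered \<open>0, \<dots>, N - 1\<close>, and site \<open>j\<close> has the local basis labels \<open>0, \<dots>, \<delta> j - 1\<close>.
  A vector of the tensor product of the local spaces is represented by its coefficient function
  with respect to the product basis; it is \<open>0\<close> outside the set of basis labels, so that distinct
  functions are distinct vectors.
\<close>

definition configs :: "nat \<Rightarrow> (nat \<Rightarrow> nat) \<Rightarrow> (nat \<Rightarrow> nat) set" where
  "configs N \<delta> = (\<Pi>\<^sub>E j\<in>{..<N}. {..<\<delta> j})"

definition state_space :: "nat \<Rightarrow> (nat \<Rightarrow> nat) \<Rightarrow> ((nat \<Rightarrow> nat) \<Rightarrow> complex) set" where
  "state_space N \<delta> = {\<psi>. \<forall>\<sigma>. \<sigma> \<notin> configs N \<delta> \<longrightarrow> \<psi> \<sigma> = 0}"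

definition state_norm :: "nat \<Rightarrow> (nat \<Rightarrow> nat) \<Rightarrow> ((nat \<Rightarrow> nat) \<Rightarrow> complex) \<Rightarrow> real" where
  "state_norm N \<delta> \<psi> = sqrt (\<Sum>\<sigma>\<in>configs N \<delta>. (cmod (\<psi> \<sigma>))\<^sup>2)"

definition state_dist ::
  "nat \<Rightarrow> (nat \<Rightarrow> nat) \<Rightarrow> ((nat \<Rightarrow> nat) \<Rightarrow> complex) \<Rightarrow> ((nat \<Rightarrow> nat) \<Rightarrow> complex) \<Rightarrow> real" where
  "state_dist N \<delta> \<phi> \<psi> = state_norm N \<delta> (\<lambda>\<sigma>. \<phi> \<sigma> - \<psi> \<sigma>)"

definition state_topology :: "nat \<Rightarrow> (nat \<Rightarrow> nat) \<Rightarrow> ((nat \<Rightarrow> nat) \<Rightarrow> complex) topology" where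
  "state_topology N \<delta> = Metric_space.mtopology (state_space N \<delta>) (state_dist N \<delta>)"

definition mat_trace :: "'a::comm_monoid_add mat \<Rightarrow> 'a" where
  "mat_trace M = (\<Sum>i<dim_row M. M $$ (i, i))"

text \<open>\<open>A j s\<close> is the \<open>m \<times> m\<close> matrix of site \<open>j\<close> belonging to the local basis label \<open>s\<close>.\<close>

definition mps ::
  "nat \<Rightarrow> nat \<Rightarrow> (nat \<Rightarrow> nat) \<Rightarrow> (nat \<Rightarrow> nat \<Rightarrow> complex mat) \<Rightarrow> (nat \<Rightarrow> nat) \<Rightarrow> complex" where
  "mps N m \<delta> A = (\<lambda>\<sigma>. if \<sigma> \<in> configs N \<delta>
     then mat_trace (foldr (*) (map (\<lambda>j. A j (\<sigma> j)) [0..<N]) (1\<^sub>m m)) else 0)"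

definition pMPS_n :: "nat \<Rightarrow> nat \<Rightarrow> (nat \<Rightarrow> nat) \<Rightarrow> ((nat \<Rightarrow> nat) \<Rightarrow> complex) set" where
  "pMPS_n N m \<delta> = {mps N m \<delta> A | A.
     (\<forall>j<N. \<forall>s<\<delta> j. A j s \<in> carrier_mat m m) \<and> state_norm N \<delta> (mps N m \<delta> A) = 1}"

lemma finite_configs: "finite (configs N \<delta>)"
  unfolding configs_def by (intro finite_PiE) auto

lemma state_norm_L2_set: "state_norm N \<delta> \<psi> = L2_set (\<lambda>\<sigma>. cmod (\<psi> \<sigma>)) (configs N \<delta>)"
  by (simp add: state_norm_def L2_set_def)

lemma Metric_space_state: "Metric_space (state_space N \<delta>) (state_dist N \<delta>)"
proof
  fix x y z :: "(nat \<Rightarrow> nat) \<Rightarrow> complex"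
  show "0 \<le> state_dist N \<delta> x y"
    by (simp add: state_dist_def state_norm_L2_set)
  show "state_dist N \<delta> x y = state_dist N \<delta> y x"
    by (simp add: state_dist_def state_norm_L2_set norm_minus_commute)
  show "state_dist N \<delta> x y = 0 \<longleftrightarrow> x = y" if "x \<in> state_space N \<delta>" "y \<in> state_space N \<delta>"
  proof -
    have "state_dist N \<delta> x y = 0 \<longleftrightarrow> (\<forall>\<sigma>\<in>configs N \<delta>. x \<sigma> = y \<sigma>)"
      by (simp add: state_dist_def state_norm_L2_set L2_set_eq_0_iff finite_configs)
    also have "\<dots> \<longleftrightarrow> x = y"
      using that by (fastforce simp: state_space_def fun_eq_iff)
    finally show ?thesis .
  qed
  show "state_dist N \<delta> x z \<le> state_dist N \<delta> x y + state_dist N \<delta> y z"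
  proof -
    have "state_dist N \<delta> x z \<le> L2_set (\<lambda>\<sigma>. cmod (x \<sigma> - y \<sigma>) + cmod (y \<sigma> - z \<sigma>)) (configs N \<delta>)"
      unfolding state_dist_def state_norm_L2_set
      by (intro L2_set_mono) (auto intro: norm_triangle_le_diff norm_diff_triangle_le)
    also have "\<dots> \<le> state_dist N \<delta> x y + state_dist N \<delta> y z"
      unfolding state_dist_def state_norm_L2_set by (rule L2_set_triangle_ineq)
    finally show ?thesis .
  qed
qed

lemma topspace_state_topology: "topspace (state_topology N \<delta>) = state_space N \<delta>"
  by (simp add: state_topology_def Metric_space.topspace_mtopology[OF Metric_space_state])

lemma pMPS_n_subset: "pMPS_n N m \<delta> \<subseteq> state_space N \<delta>"
  by (auto simp: pMPS_n_def state_space_def mps_def)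

end

theory Submission
  imports Defs "Jordan_Normal_Form.Determinant"
begin

text \<open>
  After grouping the sites, cluster \<open>c\<close> carries an \<open>m \<times> m\<close> matrix \<open>X c\<close>, and the trace of the product of
  the \<open>X c\<close> is a sum over the bond indices. Split the index set of every bond into two
  nonempty classes, and multiply an entry of \<open>X c\<close> whose two indices lie in different classes
  by \<open>\<epsilon>\<close> if \<open>c > 0\<close> and by \<open>1 / \<epsilon>\<close> if \<open>c = 0\<close>. Going around the ring the class changes an even number of
  times, so the coefficient of a bond configuration with \<open>n\<close> changes inside the clusters \<open>c > 0\<close> is \<open>\<epsilon>\<close> to the
  power \<open>n\<close> or \<open>n - 1\<close>, whichever is even. As \<open>\<epsilon> \<longlonglongrightarrow> 0\<close> exactly the configurations with at
  most one change survive.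

  The limit is not a matrix product state: every matrix unit of every cluster occurs in it, hence the
  matrices of a representation would be linearly independent and span all \<open>m \<times> m\<close> matrices, and the rank of
  a bilinear form obtained from the limit contradicts this. It remains to realise the weighted states by \<open>m \<times> m\<close>
  matrices at single sites. This is possible if one class per bond is read off from a digit
  of the bond index that is produced at a single site, while the other class is arbitrary.
\<close>

section \<open>Products of matrices and linear systems\<close>

definition mprod :: "nat \<Rightarrow> complex mat list \<Rightarrow> complex mat" where
  "mprod m Ms = foldr (*) Ms (1\<^sub>m m)"

lemma mprod_simps [simp]:
  "mprod m [] = 1\<^sub>m m" "mprod m (M # Ms) = M * mprod m Ms"
  by (simp_all add: mprod_def)

lemma mprod_carrier:
  "set Ms \<subseteq> carrier_mat m m \<Longrightarrow> mprod m Ms \<in> carrier_mat m m"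
  by (induction Ms) auto

lemma mprod_append:
  "set Ms \<subseteq> carrier_mat m m \<Longrightarrow> set Ns \<subseteq> carrier_mat m m \<Longrightarrow>
    mprod m (Ms @ Ns) = mprod m Ms * mprod m Ns"
  by (induction Ms) (auto simp: mprod_carrier assoc_mult_mat[of _ m m _ m _ m] left_mult_one_mat[OF mprod_carrier])

lemma mprod_concat:
  "(\<And>Ms. Ms \<in> set Mss \<Longrightarrow> set Ms \<subseteq> carrier_mat m m) \<Longrightarrow>
    mprod m (concat Mss) = mprod m (map (mprod m) Mss)"
proof (induction Mss)
  case (Cons Ms Mss)
  have "set (concat Mss) \<subseteq> carrier_mat m m" using Cons.prems by fastforce
  then show ?case using Cons by (simp add: mprod_append)
qed simp

section \<open>Traces of matrix products\<close>

lemma mat_trace_mult: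
  assumes "A \<in> carrier_mat m m" "B \<in> carrier_mat m m"
  shows "mat_trace (A * B) = (\<Sum>i<m. \<Sum>j<m. A $$ (i, j) * B $$ (j, i))"
  using assms by (auto simp: mat_trace_def scalar_prod_def atLeast0LessThan intro!: sum.cong)

lemma mat_trace_comm:
  fixes A B :: "'a::comm_semiring_0 mat"
  assumes "A \<in> carrier_mat m m" "B \<in> carrier_mat m m"
  shows "mat_trace (A * B) = mat_trace (B * A)"
  unfolding mat_trace_mult[OF assms] mat_trace_mult[OF assms(2,1)]
  by (subst sum.swap) (simp add: mult.commute)

text \<open>Linearity of the trace in one factor. The expansion of \<open>M\<close> is assumed entry
  by entry, so that no finite sum of matrices has to be formed.\<close>

lemma mat_trace_mult_sum:
  fixes L M :: "complex mat"
  assumes "L \<in> carrier_mat m m" "M \<in> carrier_mat m m" "\<And>p. p \<in> S \<Longrightarrow> B p \<in> carrier_mat m m"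
    and "\<And>i j. i < m \<Longrightarrow> j < m \<Longrightarrow> M $$ (i, j) = (\<Sum>p\<in>S. x p * B p $$ (i, j))"
  shows "mat_trace (L * M) = (\<Sum>p\<in>S. x p * mat_trace (L * B p))"
proof -
  have "mat_trace (L * M) = (\<Sum>i<m. \<Sum>j<m. \<Sum>p\<in>S. x p * (L $$ (i, j) * B p $$ (j, i)))"
    using assms by (simp add: mat_trace_mult sum_distrib_left mult_ac)
  also have "\<dots> = (\<Sum>p\<in>S. \<Sum>i<m. \<Sum>j<m. x p * (L $$ (i, j) * B p $$ (j, i)))"
    by (subst sum.swap[of _ S]) (simp add: sum.swap[of _ S])
  also have "\<dots> = (\<Sum>p\<in>S. x p * mat_trace (L * B p))"
    using assms by (intro sum.cong refl) (simp add: mat_trace_mult sum_distrib_left)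
  finally show ?thesis .
qed

text \<open>Cyclicity of the trace; it allows the reading of the ring to start at any site.\<close>

lemma mat_trace_mprod_rotate:
  assumes "set Ms \<subseteq> carrier_mat m m"
  shows "mat_trace (mprod m (rotate n Ms)) = mat_trace (mprod m Ms)"
proof -
  define k where "k = n mod length Ms"
  have *: "set (drop k Ms) \<subseteq> carrier_mat m m" "set (take k Ms) \<subseteq> carrier_mat m m"
    using assms set_take_subset[of k Ms] set_drop_subset[of k Ms] by blast+
  have "mat_trace (mprod m (rotate n Ms)) = mat_trace (mprod m (drop k Ms) * mprod m (take k Ms))"
    using * by (simp add: rotate_drop_take k_def mprod_append)
  also have "\<dots> = mat_trace (mprod m (take k Ms) * mprod m (drop k Ms))"
    using * by (intro mat_trace_comm[of _ m] mprod_carrier)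
  also have "\<dots> = mat_trace (mprod m Ms)"
    using * by (simp flip: mprod_append)
  finally show ?thesis .
qed

text \<open>By cyclicity the trace is a linear functional of the factor at slot \<open>c\<close>;
  \<open>R\<close> is the product of the factors after the slot followed by those before it.\<close>

lemma mat_trace_mprod_slot:
  assumes "c < K" "\<And>k. k < K \<Longrightarrow> k \<noteq> c \<Longrightarrow> F k \<in> carrier_mat m m"
  obtains R where "R \<in> carrier_mat m m"
    "\<And>X. X \<in> carrier_mat m m \<Longrightarrow>
      mat_trace (mprod m (map (\<lambda>k. if k = c then X else F k) [0..<K])) = mat_trace (R * X)"
proof
  define P where "P = mprod m (map F [0..<c])"
  define S where "S = mprod m (map F [Suc c..<K])"
  have P: "P \<in> carrier_mat m m" and S: "S \<in> carrier_mat m m"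
    unfolding P_def S_def using assms by (auto intro!: mprod_carrier)
  then show SP: "S * P \<in> carrier_mat m m" by simp
  fix X :: "complex mat" assume X: "X \<in> carrier_mat m m"
  have split: "[0..<K] = [0..<c] @ c # [Suc c..<K]"
    using assms(1) by (metis upt_add_eq_append upt_conv_Cons le_add_diff_inverse less_imp_le zero_le)
  have "mprod m (map (\<lambda>k. if k = c then X else F k) [0..<K])
      = mprod m (map (\<lambda>k. if k = c then X else F k) [0..<c]) *
        (X * mprod m (map (\<lambda>k. if k = c then X else F k) [Suc c..<K]))"
    unfolding split using assms X by (simp add: mprod_append image_subset_iff)
  also have "map (\<lambda>k. if k = c then X else F k) [0..<c] = map F [0..<c]" by simp
  also have "map (\<lambda>k. if k = c then X else F k) [Suc c..<K] = map F [Suc c..<K]" by simp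
  finally have "mprod m (map (\<lambda>k. if k = c then X else F k) [0..<K]) = P * (X * S)"
    by (simp add: P_def S_def)
  moreover have "mat_trace (P * (X * S)) = mat_trace ((X * S) * P)"
    using P S X by (intro mat_trace_comm) auto
  moreover have "(X * S) * P = X * (S * P)"
    using P S X by simp
  moreover have "mat_trace (X * (S * P)) = mat_trace (S * P * X)"
    using SP X by (intro mat_trace_comm)
  ultimately show "mat_trace (mprod m (map (\<lambda>k. if k = c then X else F k) [0..<K])) = mat_trace (S * P * X)"
    by simp
qed

text \<open>An injective square linear system is surjective. The index sets are arbitrary finite
  sets because unknowns and equations are later indexed by pairs of bond indices.\<close>

lemma square_system_solvable:
  fixes G :: "'a \<Rightarrow> 'b \<Rightarrow> 'c::field"
  assumes fin: "finite S" "finite T" and card: "card S = card T"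
    and inj: "\<And>x. (\<forall>t\<in>T. (\<Sum>s\<in>S. x s * G s t) = 0) \<Longrightarrow> \<forall>s\<in>S. x s = 0"
  obtains x where "\<And>t. t \<in> T \<Longrightarrow> (\<Sum>s\<in>S. x s * G s t) = y t"
proof -
  define n where "n = card S"
  obtain e where e: "bij_betw e {..<n} S"
    using fin(1) ex_bij_betw_nat_finite[of S] by (auto simp: n_def atLeast0LessThan)
  obtain f where f: "bij_betw f {..<n} T"
    using fin(2) card ex_bij_betw_nat_finite[of T] by (auto simp: n_def atLeast0LessThan)
  define H where "H = Matrix.mat n n (\<lambda>(i, j). G (e j) (f i))"
  have H: "H \<in> carrier_mat n n" by (simp add: H_def)
  have Hv: "(H *\<^sub>v v) $ i = (\<Sum>s\<in>S. v $ inv_into {..<n} e s * G s (f i))"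
    if "v \<in> carrier_vec n" "i < n" for v i
  proof -
    have "(\<Sum>s\<in>S. v $ inv_into {..<n} e s * G s (f i)) = (\<Sum>j<n. v $ j * G (e j) (f i))"
      using e by (subst sum.reindex_bij_betw[OF e, symmetric])
        (auto intro!: sum.cong simp: bij_betw_inv_into_left)
    then show ?thesis
      using that by (simp add: H_def scalar_prod_def atLeast0LessThan mult.commute)
  qed
  have "Determinant.det H \<noteq> 0"
  proof
    assume "Determinant.det H = 0"
    then obtain v where v: "v \<in> carrier_vec n" "v \<noteq> 0\<^sub>v n" "H *\<^sub>v v = 0\<^sub>v n"
      using det_0_iff_vec_prod_zero[OF H] by blast
    have "\<forall>t\<in>T. (\<Sum>s\<in>S. v $ inv_into {..<n} e s * G s t) = 0"
    proof
      fix t assume "t \<in> T"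
      then obtain i where i: "i < n" "t = f i" using f by (auto simp: bij_betw_def)
      then show "(\<Sum>s\<in>S. v $ inv_into {..<n} e s * G s t) = 0"
        using Hv[OF v(1) i(1)] v(3) by simp
    qed
    from inj[OF this] have "v $ i = 0" if "i < n" for i
      using that e by (metis bij_betwE bij_betw_inv_into_left lessThan_iff)
    then have "v = 0\<^sub>v n" using v(1) by (intro eq_vecI) auto
    with v(2) show False by simp
  qed
  \<comment> \<open>\<open>undefined\<close> fills the extension field of the record
    \<open>ring_mat\<close>, on which the units do not depend.\<close>
  then obtain H' where H': "H' \<in> carrier_mat n n" "H * H' = 1\<^sub>m n"
    using det_non_zero_imp_unit[OF H, of undefined] by (auto simp: Units_def ring_mat_def)
  define v where "v = H' *\<^sub>v Matrix.vec n (\<lambda>i. y (f i))"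
  have v: "v \<in> carrier_vec n" using H' by (simp add: v_def)
  have "H *\<^sub>v v = (H * H') *\<^sub>v Matrix.vec n (\<lambda>i. y (f i))"
    unfolding v_def by (rule assoc_mult_mat_vec[symmetric, OF H H'(1)]) simp
  then have "H *\<^sub>v v = Matrix.vec n (\<lambda>i. y (f i))"
    unfolding H'(2) by simp
  then have "(\<Sum>s\<in>S. v $ inv_into {..<n} e s * G s (f i)) = y (f i)" if "i < n" for i
    using Hv[OF v that] that by simp
  then have "(\<Sum>s\<in>S. v $ inv_into {..<n} e s * G s t) = y t" if "t \<in> T" for t
    using that f by (auto simp: bij_betw_def)
  then show ?thesis by (rule that)
qed

section \<open>The limit tensor\<close>

text \<open>\<open>t c\<close> stands for the class on the bond to the left of cluster
  \<open>c\<close>. Cluster 0 is left out: whether the class changes there is determined by the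
  parity of the other changes.\<close>

definition flips :: "nat \<Rightarrow> (nat \<Rightarrow> bool) \<Rightarrow> nat" where
  "flips K t = card {c\<in>{1..<K}. t c \<noteq> t (Suc c mod K)}"

text \<open>The ring is cut into two arcs, one carrying the class of \<open>p\<close> and the other
  that of \<open>q\<close>. If the classes differ, one of the two changes happens at cluster 0,
  which \<open>flips\<close> does not count.\<close>

lemma exists_few_flips:
  assumes K: "3 \<le> K" and c: "c < K" and pq: "p < m" "q < m"
    and T: "\<And>c z. c < K \<Longrightarrow> \<exists>x<m. T c x = z"
  obtains a where "\<And>k. k < K \<Longrightarrow> a k < m" "a c = p" "a (Suc c mod K) = q"
    "flips K (\<lambda>k. T k (a k)) \<le> 1"
proof -
  obtain rep where rep: "\<And>k z. k < K \<Longrightarrow> rep k z < m \<and> T k (rep k z) = (z::bool)"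
    using T by metis
  \<comment> \<open>For \<open>c > 0\<close> the bonds from 1 to \<open>c\<close> get the class of
    \<open>p\<close> and the others, including bond 0, that of \<open>q\<close>. For
    \<open>c = 0\<close> only bond 0 gets the class of \<open>p\<close>, so the counted change is at
    cluster \<open>K - 1\<close>.\<close>
  define z where "z k = (if (c = 0 \<and> k = 0) \<or> (1 \<le> k \<and> k \<le> c)
    then T c p else T (Suc c mod K) q)" for k
  define a where "a k = (if k = c then p else if k = Suc c mod K then q else rep k (z k))" for k
  have ne: "Suc c mod K \<noteq> c" using K c by (cases "Suc c = K") auto
  have nz: "\<not> ((c = 0 \<and> Suc c mod K = 0) \<or> (1 \<le> Suc c mod K \<and> Suc c mod K \<le> c))"
    using K c by (cases "Suc c = K") auto
  have Ta: "T k (a k) = z k" if "k < K" for k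
    using rep[OF that, of "z k"] nz by (auto simp: a_def z_def)
  have "{k\<in>{1..<K}. T k (a k) \<noteq> T (Suc k mod K) (a (Suc k mod K))} \<subseteq> {if c = 0 then K - 1 else c}"
  proof
    fix k assume k: "k \<in> {k\<in>{1..<K}. T k (a k) \<noteq> T (Suc k mod K) (a (Suc k mod K))}"
    moreover have "k < K" "Suc k mod K < K" using k K by auto
    ultimately have "z k \<noteq> z (Suc k mod K)" by (simp add: Ta)
    with k show "k \<in> {if c = 0 then K - 1 else c}"
      using c by (cases "Suc k = K") (auto simp: z_def split: if_splits)
  qed
  then have "flips K (\<lambda>k. T k (a k)) \<le> card {if c = 0 then K - 1 else c}"
    unfolding flips_def by (intro card_mono) auto
  then show ?thesis
    using that[of a] ne rep pq by (auto simp: a_def)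
qed

text \<open>
  Fix the factor at slot 1 to a matrix unit whose indices lie in different classes. The bilinear
  form left in slots 0 and 2 has rank less than \<open>m\<close>, because the index
  of bond 3 is confined to a single class. For a trace of a product of arbitrary linear images of
  the factors the rank would be at least \<open>m\<close>.
\<close>

lemma few_flips_not_mps:
  fixes B :: "nat \<Rightarrow> nat \<Rightarrow> nat \<Rightarrow> complex mat"
  assumes K: "3 \<le> K" and w: "w \<noteq> 0"
    and B: "\<And>c a b. c < K \<Longrightarrow> a < m \<Longrightarrow> b < m \<Longrightarrow> B c a b \<in> carrier_mat m m"
    and T: "\<And>c z. c < K \<Longrightarrow> \<exists>x<m. T c x = z"
    and val: "\<And>a b. (\<And>c. c < K \<Longrightarrow> a c < m) \<Longrightarrow> (\<And>c. c < K \<Longrightarrow> b c < m) \<Longrightarrow>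
      mat_trace (mprod m (map (\<lambda>c. B c (a c) (b c)) [0..<K])) =
      (if (\<forall>c<K. b c = a (Suc c mod K)) \<and> flips K (\<lambda>c. T c (a c)) \<le> 1 then w else 0)"
  shows False
proof -
  define S where "S = {..<m} \<times> {..<m}"
  define B' where "B' c s = B c (fst s) (snd s)" for c s
  have B': "B' c s \<in> carrier_mat m m" if "c < K" "s \<in> S" for c s
    using B that by (auto simp: B'_def S_def)
  have [simp]: "finite S" by (simp add: S_def)

  \<comment> \<open>Completing the indices of \<open>s\<close> to a bond configuration with few
    flips and multiplying the other factors into \<open>R\<close> gives a dual functional: its value
    is \<open>w\<close> on \<open>B' c s\<close> and 0 on every other
    \<open>B' c s'\<close>.\<close>
  have indep: "\<forall>s\<in>S. x s = 0" if c: "c < K"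
    and zero: "\<forall>t\<in>S. (\<Sum>s\<in>S. x s * B' c s $$ t) = 0" for c x
  proof
    fix s assume s: "s \<in> S"
    obtain p q where pq: "s = (p, q)" "p < m" "q < m" using s by (auto simp: S_def)
    obtain a where a: "\<And>k. k < K \<Longrightarrow> a k < m" "a c = p" "a (Suc c mod K) = q"
      "flips K (\<lambda>k. T k (a k)) \<le> 1"
      using exists_few_flips[OF K c pq(2,3), of T] T by blast
    define F where "F k = B k (a k) (a (Suc k mod K))" for k
    obtain R where R: "R \<in> carrier_mat m m" "\<And>X. X \<in> carrier_mat m m \<Longrightarrow>
      mat_trace (mprod m (map (\<lambda>k. if k = c then X else F k) [0..<K])) = mat_trace (R * X)"
      using mat_trace_mprod_slot[OF c, of F m] B a(1) by (auto simp: F_def)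
    have ne: "Suc c mod K \<noteq> c" using K c by (cases "Suc c = K") auto
    have tr: "mat_trace (R * B' c s') = (if s' = s then w else 0)" if s': "s' \<in> S" for s'
    proof -
      obtain p' q' where pq': "s' = (p', q')" "p' < m" "q' < m" using s' by (auto simp: S_def)
      let ?a = "a(c := p')" and ?b = "(\<lambda>k. a (Suc k mod K))(c := q')"
      have "mat_trace (R * B' c s') = mat_trace (mprod m (map (\<lambda>k. B k (?a k) (?b k)) [0..<K]))"
        unfolding R(2)[OF B'[OF c s'], symmetric]
        by (intro arg_cong[of _ _ "\<lambda>Ms. mat_trace (mprod m Ms)"] map_cong) (auto simp: F_def B'_def pq')
      also have "\<dots> = (if (\<forall>k<K. ?b k = ?a (Suc k mod K)) \<and> flips K (\<lambda>k. T k (?a k)) \<le> 1 then w else 0)"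
        using pq' a(1) K by (intro val) auto
      also have "(\<forall>k<K. ?b k = ?a (Suc k mod K)) \<longleftrightarrow> p' = p \<and> q' = q"
      proof
        assume *: "\<forall>k<K. ?b k = ?a (Suc k mod K)"
        \<comment> \<open>\<open>k\<close> is the cluster preceding \<open>c\<close>; matching on
          the bond between them forces \<open>p' = p\<close>.\<close>
        obtain k where k: "k < K" "Suc k mod K = c"
        proof (cases c)
          case 0 then show ?thesis using that[of "K - 1"] K by simp
        next
          case (Suc k) then show ?thesis using that[of k] c by simp
        qed
        have "k \<noteq> c" using k ne by auto
        then have "p' = p" using *[rule_format, OF k(1)] k a(2) by auto
        moreover have "q' = q" using *[rule_format, OF c] ne a(3) by auto
        ultimately show "p' = p \<and> q' = q" ..
      next
        assume *: "p' = p \<and> q' = q"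
        then have "?a = a" using a(2) by auto
        then show "\<forall>k<K. ?b k = ?a (Suc k mod K)" using * a(3) by auto
      qed
      also have "(if (p' = p \<and> q' = q) \<and> flips K (\<lambda>k. T k (?a k)) \<le> 1 then w else 0)
          = (if s' = s then w else 0)"
      proof (cases "p' = p \<and> q' = q")
        case True
        then have "?a = a" using a(2) by auto
        then show ?thesis using True a(4) by (simp add: pq pq')
      qed (auto simp: pq pq')
      finally show ?thesis .
    qed
    have "mat_trace (R * 0\<^sub>m m m) = (\<Sum>s\<in>S. x s * mat_trace (R * B' c s))"
      using R(1) B'[OF c] zero by (intro mat_trace_mult_sum) (auto simp: S_def)
    also have "\<dots> = (\<Sum>s'\<in>S. if s' = s then x s * w else 0)" by (intro sum.cong) (auto simp: tr)
    also have "\<dots> = x s * w" using s by simp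
    also have "mat_trace (R * 0\<^sub>m m m) = 0" using R(1) by (simp add: mat_trace_def)
    finally show "x s = 0" using w by simp
  qed

  \<comment> \<open>There are as many independent matrices \<open>B' c s\<close> as matrix entries,
    so they span.\<close>
  have span: "\<exists>x. \<forall>i<m. \<forall>j<m. M $$ (i, j) = (\<Sum>s\<in>S. x s * B' c s $$ (i, j))"
    if c: "c < K" for c and M :: "complex mat"
  proof -
    obtain x where x: "\<And>t. t \<in> S \<Longrightarrow> (\<Sum>s\<in>S. x s * B' c s $$ t) = M $$ t"
      using square_system_solvable[of S S "\<lambda>s t. B' c s $$ t" "\<lambda>t. M $$ t"] indep[OF c] by auto
    then show ?thesis by (intro exI[of _ x]) (auto simp: S_def)
  qed

  \<comment> \<open>The classes of \<open>p\<close> and \<open>q\<close> differ, so the indices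
    \<open>(p, q)\<close> at cluster 1 use up the single permitted flip.\<close>
  obtain p where p: "p < m" "T 1 p" using T[of 1 True] K by auto
  obtain q where q: "q < m" "\<not> T 2 q" using T[of 2 False] K by auto
  define M where "M = B 1 p q"
  have M: "M \<in> carrier_mat m m" using B[of 1 p q] K p q by (simp add: M_def)
  have "\<exists>p' q'. p' < m \<and> q' < m \<and> M $$ (p', q') \<noteq> 0"
  proof (rule ccontr)
    assume "\<not> ?thesis"
    then have zero: "M $$ (i, j) = 0" if "i < m" "j < m" for i j using that by blast
    have sum0: "\<forall>t\<in>S. (\<Sum>s\<in>S. (if s = (p, q) then 1 else 0) * B' 1 s $$ t) = 0"
    proof
      fix t assume "t \<in> S"
      have "(\<Sum>s\<in>S. (if s = (p, q) then 1 else 0) * B' 1 s $$ t)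
          = (\<Sum>s\<in>S. if s = (p, q) then M $$ t else 0)"
        by (intro sum.cong) (auto simp: B'_def M_def)
      then show "(\<Sum>s\<in>S. (if s = (p, q) then 1 else 0) * B' 1 s $$ t) = 0"
        using \<open>t \<in> S\<close> zero by (auto simp: S_def)
    qed
    have "(if (p, q) = (p, q) then 1 else 0 :: complex) = 0"
      using K p q by (intro indep[OF _ sum0, THEN bspec]) (auto simp: S_def)
    then show False by simp
  qed
  then obtain p' q' where pq': "p' < m" "q' < m" "M $$ (p', q') \<noteq> 0" by blast

  \<comment> \<open>With the flip spent at cluster 1, cluster 2 must keep the class, so bond 3
    carries the class of \<open>q\<close>, for which \<open>T\<close> is false. For
    \<open>K = 3\<close> bond 3 is bond 0.\<close>
  define cl where "cl i \<longleftrightarrow> \<not> T (3 mod K) i" for i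
  \<comment> \<open>The zero pattern that survives when only the first \<open>k\<close> factors are
    kept; going down from \<open>K\<close> to 3 removes all slots from 3 on.\<close>
  define V where "V k \<longleftrightarrow> (\<forall>a b. (\<forall>c<k. a c < m \<and> b c < m) \<and> a 1 = p \<and> b 1 = q \<and>
      \<not> (b 0 = p \<and> a 2 = q \<and> cl (b 2)) \<longrightarrow>
      mat_trace (mprod m (map (\<lambda>c. B c (a c) (b c)) [0..<k])) = 0)" for k
  have "V K"
    unfolding V_def
  proof (intro allI impI)
    fix a b :: "nat \<Rightarrow> nat"
    assume *: "(\<forall>c<K. a c < m \<and> b c < m) \<and> a 1 = p \<and> b 1 = q \<and> \<not> (b 0 = p \<and> a 2 = q \<and> cl (b 2))"
    have "\<not> ((\<forall>c<K. b c = a (Suc c mod K)) \<and> flips K (\<lambda>c. T c (a c)) \<le> 1)"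
    proof
      assume A: "(\<forall>c<K. b c = a (Suc c mod K)) \<and> flips K (\<lambda>c. T c (a c)) \<le> 1"
      then have b: "b 0 = a 1" "b 1 = a 2" "b 2 = a (3 mod K)"
        using K by (auto simp: numeral_eq_Suc)
      have "T 2 (a 2) = T (3 mod K) (a (3 mod K))"
      proof (rule ccontr)
        assume "T 2 (a 2) \<noteq> T (3 mod K) (a (3 mod K))"
        then have "{1, 2} \<subseteq> {c\<in>{1..<K}. T c (a c) \<noteq> T (Suc c mod K) (a (Suc c mod K))}"
          using K p q * b by (auto simp: numeral_eq_Suc)
        then have "card {1, 2::nat} \<le> flips K (\<lambda>c. T c (a c))"
          unfolding flips_def by (intro card_mono) auto
        then show False using A by simp
      qed
      then show False using * b q by (auto simp: cl_def)
    qed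
    then show "mat_trace (mprod m (map (\<lambda>c. B c (a c) (b c)) [0..<K])) = 0"
      using val[of a b] * by auto
  qed
  \<comment> \<open>The identity matrix is a combination of the \<open>B' k s\<close>. Inserting it
    after the first \<open>k\<close> factors turns their trace into a combination of traces covered
    by \<open>V (Suc k)\<close>.\<close>
  have step: "V k" if k: "V (Suc k)" "3 \<le> k" "k < K" for k
    unfolding V_def
  proof (intro allI impI)
    fix a b :: "nat \<Rightarrow> nat"
    assume *: "(\<forall>c<k. a c < m \<and> b c < m) \<and> a 1 = p \<and> b 1 = q \<and> \<not> (b 0 = p \<and> a 2 = q \<and> cl (b 2))"
    define L where "L = mprod m (map (\<lambda>c. B c (a c) (b c)) [0..<k])"
    have L: "L \<in> carrier_mat m m"
      unfolding L_def using * k(3) by (auto intro!: mprod_carrier B)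
    obtain x where x: "\<forall>i<m. \<forall>j<m. 1\<^sub>m m $$ (i, j) = (\<Sum>s\<in>S. x s * B' k s $$ (i, j))"
      using span[OF k(3)] by blast
    have "mat_trace (L * 1\<^sub>m m) = (\<Sum>s\<in>S. x s * mat_trace (L * B' k s))"
      using L x B'[OF k(3)] by (intro mat_trace_mult_sum) auto
    also have "\<dots> = 0"
    proof (intro sum.neutral ballI)
      fix s assume s: "s \<in> S"
      let ?a = "a(k := fst s)" and ?b = "b(k := snd s)"
      have "mprod m (map (\<lambda>c. B c (?a c) (?b c)) [0..<Suc k])
          = mprod m (map (\<lambda>c. B c (?a c) (?b c)) [0..<k]) * B' k s"
        using * k B'[OF k(3) s] by (simp add: mprod_append image_subset_iff B B'_def)
      also have "map (\<lambda>c. B c (?a c) (?b c)) [0..<k] = map (\<lambda>c. B c (a c) (b c)) [0..<k]" by simp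
      finally have "L * B' k s = mprod m (map (\<lambda>c. B c (?a c) (?b c)) [0..<Suc k])"
        by (simp add: L_def)
      moreover have "mat_trace (mprod m (map (\<lambda>c. B c (?a c) (?b c)) [0..<Suc k])) = 0"
        using * k s by (intro k(1)[unfolded V_def, rule_format]) (auto simp: S_def less_Suc_eq)
      ultimately show "x s * mat_trace (L * B' k s) = 0" by simp
    qed
    finally show "mat_trace (mprod m (map (\<lambda>c. B c (a c) (b c)) [0..<k])) = 0"
      using L by (simp add: L_def)
  qed
  have V3: "V 3"
    using K \<open>V K\<close> by (rule inc_induct) (use step in auto)
  define \<theta> where "\<theta> s0 s2 = mat_trace (B' 0 s0 * (M * B' 2 s2))" for s0 s2
  have \<theta>: "\<theta> (a0, b0) (a2, b2) = 0"
    if "a0 < m" "b0 < m" "a2 < m" "b2 < m" "\<not> (b0 = p \<and> a2 = q \<and> cl b2)" for a0 b0 a2 b2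
  proof -
    let ?a = "\<lambda>c::nat. if c = 0 then a0 else if c = 1 then p else a2"
    let ?b = "\<lambda>c::nat. if c = 0 then b0 else if c = 1 then q else b2"
    have "mat_trace (mprod m (map (\<lambda>c. B c (?a c) (?b c)) [0..<3])) = 0"
      using that p q by (intro V3[unfolded V_def, rule_format]) auto
    moreover have "[0..<3] = [0, 1, 2::nat]" by (simp add: upt_rec)
    moreover have "B 2 a2 b2 \<in> carrier_mat m m" using B[of 2 a2 b2] that K by simp
    ultimately show ?thesis by (simp add: \<theta>_def B'_def M_def)
  qed

  \<comment> \<open>\<open>x2 r\<close> and \<open>x0 r\<close> are coordinates of matrix units in
    the spanning families of slots 2 and 0; the row \<open>q'\<close> and the column
    \<open>p'\<close> single out the nonzero entry of \<open>M\<close>.\<close>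
  obtain x2 where x2: "\<And>r i j. i < m \<Longrightarrow> j < m \<Longrightarrow>
      (if i = q' \<and> j = r then 1 else 0) = (\<Sum>s\<in>S. x2 r s * B' 2 s $$ (i, j))"
  proof -
    have "\<forall>r. \<exists>x. \<forall>i<m. \<forall>j<m. (if i = q' \<and> j = r then 1 else 0) = (\<Sum>s\<in>S. x s * B' 2 s $$ (i, j))"
    proof
      fix r
      show "\<exists>x. \<forall>i<m. \<forall>j<m. (if i = q' \<and> j = r then 1 else 0) = (\<Sum>s\<in>S. x s * B' 2 s $$ (i, j))"
        using span[of 2 "Matrix.mat m m (\<lambda>(i, j). if i = q' \<and> j = r then 1 else 0)"] K by simp
    qed
    then show ?thesis using that by metis
  qed
  obtain x0 where x0: "\<And>r i j. i < m \<Longrightarrow> j < m \<Longrightarrow>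
      (if i = r \<and> j = p' then 1 else 0) = (\<Sum>s\<in>S. x0 r s * B' 0 s $$ (i, j))"
  proof -
    have "\<forall>r. \<exists>x. \<forall>i<m. \<forall>j<m. (if i = r \<and> j = p' then 1 else 0) = (\<Sum>s\<in>S. x s * B' 0 s $$ (i, j))"
    proof
      fix r
      show "\<exists>x. \<forall>i<m. \<forall>j<m. (if i = r \<and> j = p' then 1 else 0) = (\<Sum>s\<in>S. x s * B' 0 s $$ (i, j))"
        using span[of 0 "Matrix.mat m m (\<lambda>(i, j). if i = r \<and> j = p' then 1 else 0)"] K by simp
    qed
    then show ?thesis using that by metis
  qed
  define E2 where "E2 r = Matrix.mat m m (\<lambda>(i, j). if i = q' \<and> j = r then 1 else 0 :: complex)" for r
  define E0 where "E0 r = Matrix.mat m m (\<lambda>(i, j). if i = r \<and> j = p' then 1 else 0 :: complex)" for r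
  have E: "E2 r \<in> carrier_mat m m" "E0 r \<in> carrier_mat m m" for r by (auto simp: E2_def E0_def)
  have B0: "B' 0 s \<in> carrier_mat m m" and B2: "B' 2 s \<in> carrier_mat m m" if "s \<in> S" for s
    using B' that K by auto

  \<comment> \<open>Evaluated directly on these matrix units, the form is a nonzero multiple of the
    identity matrix of size \<open>m\<close>.\<close>
  have lhs: "mat_trace (E0 r' * (M * E2 r)) = (if r = r' then M $$ (p', q') else 0)"
    if r: "r < m" "r' < m" for r r'
  proof -
    have ME: "(M * E2 r) $$ (i, j) = (if j = r then M $$ (i, q') else 0)" if "i < m" "j < m" for i j
    proof -
      have "(M * E2 r) $$ (i, j) = (\<Sum>k<m. M $$ (i, k) * (if k = q' \<and> j = r then 1 else 0))"
        using M E that by (auto simp: scalar_prod_def atLeast0LessThan E2_def intro!: sum.cong)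
      also have "\<dots> = (\<Sum>k<m. if k = q' then (if j = r then M $$ (i, q') else 0) else 0)"
        by (intro sum.cong) auto
      finally show ?thesis using pq' by simp
    qed
    have "mat_trace (E0 r' * (M * E2 r))
        = (\<Sum>i<m. \<Sum>j<m. (if i = r' \<and> j = p' then 1 else 0) * (if i = r then M $$ (j, q') else 0))"
      using M E by (subst mat_trace_mult[of _ m]) (auto simp: ME E0_def intro!: sum.cong simp del: index_mult_mat(1))
    also have "\<dots> = (\<Sum>i<m. \<Sum>j<m. if j = p' then (if i = r' then (if r = r' then M $$ (p', q') else 0) else 0) else 0)"
      by (intro sum.cong refl) auto
    also have "\<dots> = (\<Sum>i<m. if i = r' then (if r = r' then M $$ (p', q') else 0) else 0)"
      using pq' by (simp only: sum.delta finite_lessThan lessThan_iff if_True)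
    finally show ?thesis using pq' r by auto
  qed

  \<comment> \<open>Expanded in the coordinates, the same form factors through the indices
    \<open>i\<close> with \<open>cl i\<close>. \<open>\<Phi>\<close> and \<open>\<Psi>\<close> are
    the two factors, scaled to have product 1.\<close>
  define \<Phi> where "\<Phi> = Matrix.mat m m (\<lambda>(r, i). if cl i then x2 r (q, i) else 0)"
  define \<Psi> where "\<Psi> = Matrix.mat m m (\<lambda>(i, r). (\<Sum>a<m. x0 r (a, p) * \<theta> (a, p) (q, i)) / M $$ (p', q'))"
  have rhs: "mat_trace (E0 r' * (M * E2 r)) =
      (\<Sum>i<m. (if cl i then x2 r (q, i) else 0) * (\<Sum>a<m. x0 r' (a, p) * \<theta> (a, p) (q, i)))"
    if r: "r < m" "r' < m" for r r'
  proof -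
    have inner: "mat_trace (E0 r' * (M * B' 2 s)) = (\<Sum>s0\<in>S. x0 r' s0 * \<theta> s0 s)" if s: "s \<in> S" for s
    proof -
      have "mat_trace (E0 r' * (M * B' 2 s)) = mat_trace ((M * B' 2 s) * E0 r')"
        using M E B2[OF s] by (intro mat_trace_comm[of _ m]) auto
      also have "\<dots> = (\<Sum>s0\<in>S. x0 r' s0 * mat_trace ((M * B' 2 s) * B' 0 s0))"
        using M E B2[OF s] B0 x0 by (intro mat_trace_mult_sum) (auto simp: E0_def)
      also have "\<dots> = (\<Sum>s0\<in>S. x0 r' s0 * \<theta> s0 s)"
        unfolding \<theta>_def using M B2[OF s] B0
        by (intro sum.cong refl arg_cong[of _ _ "(*) _"] mat_trace_comm[of _ m]) auto
      finally show ?thesis .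
    qed
    have "mat_trace (E0 r' * (M * E2 r)) = mat_trace ((E0 r' * M) * E2 r)"
      using M E by (simp add: assoc_mult_mat[of _ m m _ m _ m])
    also have "\<dots> = (\<Sum>s\<in>S. x2 r s * mat_trace ((E0 r' * M) * B' 2 s))"
      using mult_carrier_mat[OF E(2) M] E(1) B2 x2 by (intro mat_trace_mult_sum) (auto simp: E2_def)
    also have "\<dots> = (\<Sum>s\<in>S. x2 r s * (\<Sum>s0\<in>S. x0 r' s0 * \<theta> s0 s))"
      using M E B2 by (intro sum.cong refl) (simp add: assoc_mult_mat[of _ m m _ m _ m] inner)
    also have "\<dots> = (\<Sum>a2<m. \<Sum>b2<m. x2 r (a2, b2) * (\<Sum>a0<m. \<Sum>b0<m. x0 r' (a0, b0) * \<theta> (a0, b0) (a2, b2)))"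
      by (simp add: S_def sum.cartesian_product)
    also have "\<dots> = (\<Sum>a2<m. \<Sum>b2<m. if a2 = q then
        (if cl b2 then x2 r (q, b2) else 0) * (\<Sum>a0<m. \<Sum>b0<m. if b0 = p then x0 r' (a0, p) * \<theta> (a0, p) (q, b2) else 0) else 0)"
      (is "(\<Sum>a2<m. \<Sum>b2<m. ?f a2 b2) = (\<Sum>a2<m. \<Sum>b2<m. ?g a2 b2)")
    proof (intro sum.cong refl)
      fix a2 b2 assume ab: "a2 \<in> {..<m}" "b2 \<in> {..<m}"
      show "?f a2 b2 = ?g a2 b2"
      proof (cases "a2 = q \<and> cl b2")
        case True
        have "x0 r' (a0, b0) * \<theta> (a0, b0) (a2, b2) = (if b0 = p then x0 r' (a0, p) * \<theta> (a0, p) (q, b2) else 0)"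
          if "a0 < m" "b0 < m" for a0 b0 using that ab True \<theta>[of a0 b0 a2 b2] by auto
        then show ?thesis using True by simp
      next
        case False
        then have "\<theta> (a0, b0) (a2, b2) = 0" if "a0 < m" "b0 < m" for a0 b0
          using that ab \<theta>[of a0 b0 a2 b2] by auto
        then have "(\<Sum>a0<m. \<Sum>b0<m. x0 r' (a0, b0) * \<theta> (a0, b0) (a2, b2)) = 0"
          by (intro sum.neutral ballI) simp
        then show ?thesis using False by auto
      qed
    qed
    also have "\<dots> = (\<Sum>b2<m. \<Sum>a2<m. if a2 = q then
        (if cl b2 then x2 r (q, b2) else 0) * (\<Sum>a0<m. \<Sum>b0<m. if b0 = p then x0 r' (a0, p) * \<theta> (a0, p) (q, b2) else 0) else 0)"
      by (rule sum.swap)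
    also have "\<dots> = (\<Sum>i<m. (if cl i then x2 r (q, i) else 0) * (\<Sum>a<m. x0 r' (a, p) * \<theta> (a, p) (q, i)))"
      using p q by (simp only: sum.delta finite_lessThan lessThan_iff if_True)
    finally show ?thesis .
  qed
  have "\<Phi> * \<Psi> = 1\<^sub>m m"
  proof (rule eq_matI)
    fix r r' assume "r < dim_row (1\<^sub>m m :: complex mat)" "r' < dim_col (1\<^sub>m m :: complex mat)"
    then have r: "r < m" "r' < m" by auto
    have "(\<Phi> * \<Psi>) $$ (r, r') = (\<Sum>i<m. (if cl i then x2 r (q, i) else 0) *
        (\<Sum>a<m. x0 r' (a, p) * \<theta> (a, p) (q, i))) / M $$ (p', q')"
      using r by (subst sum_divide_distrib)
        (auto simp: \<Phi>_def \<Psi>_def scalar_prod_def atLeast0LessThan intro!: sum.cong)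
    also have "\<dots> = (if r = r' then M $$ (p', q') else 0) / M $$ (p', q')"
      using lhs[OF r] rhs[OF r] by simp
    finally show "(\<Phi> * \<Psi>) $$ (r, r') = 1\<^sub>m m $$ (r, r')"
      using pq' r by simp
  qed (auto simp: \<Phi>_def \<Psi>_def)
  then have inv: "\<Psi> * \<Phi> = 1\<^sub>m m"
    by (intro mat_mult_left_right_inverse[of \<Phi> m]) (auto simp: \<Phi>_def \<Psi>_def)
  \<comment> \<open>The column of \<open>\<Phi>\<close> at an index outside \<open>cl\<close> is 0,
    which is impossible for an invertible matrix.\<close>
  obtain i where i: "i < m" "\<not> cl i"
    using T[of "3 mod K" True] K by (auto simp: cl_def)
  have "(\<Psi> * \<Phi>) $$ (i, i) = 0"
    using i by (auto simp: \<Phi>_def \<Psi>_def scalar_prod_def)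
  then show False using inv i by simp
qed

section \<open>Matrices at the sites of a cluster\<close>

definition words :: "nat list \<Rightarrow> nat list set" where
  "words ds = {s. list_all2 (<) s ds}"

lemma words_Nil [simp]: "words [] = {[]}"
  by (simp add: words_def)

lemma Cons_in_words [simp]: "x # s \<in> words (d # ds) \<longleftrightarrow> x < d \<and> s \<in> words ds"
  by (simp add: words_def)

lemma words_ConsE:
  assumes "w \<in> words (d # ds)"
  obtains x s where "w = x # s" "x < d" "s \<in> words ds"
  using assms by (auto simp: words_def list_all2_Cons2)

text \<open>A weighted partial map on bond indices, with \<open>None\<close> for an empty row. The
  site matrices of a cluster are built in this shape, so multiplying by one merely selects and
  weights rows of the remaining product.\<close>

definition row_map_mat :: "nat \<Rightarrow> (nat \<Rightarrow> complex) \<Rightarrow> (nat \<Rightarrow> nat option) \<Rightarrow> complex mat" where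
  "row_map_mat m w f = Matrix.mat m m (\<lambda>(i, j). if f i = Some j then w i else 0)"

lemma row_map_mat_carrier [simp]: "row_map_mat m w f \<in> carrier_mat m m"
  by (simp add: row_map_mat_def)

lemma row_map_mat_mult:
  assumes R: "R \<in> carrier_mat m m" and ij: "i < m" "j < m"
    and f: "\<And>k. f i = Some k \<Longrightarrow> k < m"
  shows "(row_map_mat m w f * R) $$ (i, j) = (case f i of None \<Rightarrow> 0 | Some k \<Rightarrow> w i * R $$ (k, j))"
proof -
  have "(row_map_mat m w f * R) $$ (i, j) = (\<Sum>k<m. (if f i = Some k then w i else 0) * R $$ (k, j))"
    using R ij by (auto simp: row_map_mat_def scalar_prod_def atLeast0LessThan intro!: sum.cong)
  also have "\<dots> = (case f i of None \<Rightarrow> 0 | Some k \<Rightarrow> w i * R $$ (k, j))"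
  proof (cases "f i")
    case (Some l)
    have "(\<Sum>k<m. (if f i = Some k then w i else 0) * R $$ (k, j)) = (\<Sum>k<m. if k = l then w i * R $$ (l, j) else 0)"
      by (intro sum.cong) (auto simp: Some)
    then show ?thesis using f[OF Some] by (simp add: Some)
  qed simp
  finally show ?thesis .
qed

section \<open>Mixed-radix digits of labels and bond indices\<close>

lemma mod_div_digit: "r < n \<Longrightarrow> (r + n * q) mod n = r \<and> (r + n * q) div n = (q::nat)"
  by simp

lemma digits_eq_iff: "r < n \<Longrightarrow> k = r + n * q \<longleftrightarrow> k mod n = r \<and> k div n = (q::nat)"
  using mod_mult_div_eq[of k n] by (metis mod_div_digit)

lemma mixed_digit_less: "r < n \<Longrightarrow> q < k \<Longrightarrow> r + n * q < n * (k::nat)"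
proof -
  assume "r < n" "q < k"
  then have "r + n * q < n + n * q" by simp
  also have "\<dots> = n * Suc q" by simp
  also have "\<dots> \<le> n * k" using \<open>q < k\<close> by (intro mult_le_mono2) simp
  finally show ?thesis .
qed

text \<open>The label of a site of dimension \<open>X * Y\<close> has two digits: the low one
  becomes the lowest digit of the left index, the high one the highest digit of the right
  index.\<close>

lemma bij_betw_words_Cons:
  fixes X Y nL nR :: nat
  assumes bij: "bij_betw (\<lambda>s. (\<alpha> s, \<beta> s)) (words ds) ({..<nL} \<times> {..<nR})"
    and pos: "0 < X" "0 < nR"
  shows "bij_betw (\<lambda>s. (hd s mod X + X * \<alpha> (tl s), \<beta> (tl s) + nR * (hd s div X)))
    (words (X * Y # ds)) ({..<X * nL} \<times> {..<nR * Y})"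
proof -
  define g where "g = inv_into (words ds) (\<lambda>s. (\<alpha> s, \<beta> s))"
  have g: "g p \<in> words ds" "\<alpha> (g p) = fst p" "\<beta> (g p) = snd p" if "p \<in> {..<nL} \<times> {..<nR}" for p
    using bij_betwE[OF bij_betw_inv_into[OF bij]] bij_betw_inv_into_right[OF bij that] that
    by (auto simp: g_def prod_eq_iff)
  have g': "g (\<alpha> s, \<beta> s) = s" "\<alpha> s < nL" "\<beta> s < nR" if "s \<in> words ds" for s
    using bij_betw_inv_into_left[OF bij that] bij_betwE[OF bij] that by (auto simp: g_def)
  define f where "f w = (hd w mod X + X * \<alpha> (tl w), \<beta> (tl w) + nR * (hd w div X))" for w
  define f' where "f' p = (fst p mod X + X * (snd p div nR)) # g (fst p div X, snd p mod nR)" for p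
  have f: "f' (f w) = w \<and> f w \<in> {..<X * nL} \<times> {..<nR * Y}" if W: "w \<in> words (X * Y # ds)" for w
  proof -
    obtain x s where w: "w = x # s" "x < X * Y" "s \<in> words ds" using W by (rule words_ConsE)
    then have "x div X < Y" using pos by (simp add: div_less_iff_less_mult mult.commute)
    with w pos g'[OF w(3)] show ?thesis
      by (auto simp: f_def f'_def intro!: mixed_digit_less)
  qed
  have f': "f (f' p) = p \<and> f' p \<in> words (X * Y # ds)" if "p \<in> {..<X * nL} \<times> {..<nR * Y}" for p
  proof -
    obtain a b where p: "p = (a, b)" "a < X * nL" "b < nR * Y" using \<open>p \<in> _\<close> by auto
    then have *: "a div X < nL" "b div nR < Y" "b mod nR < nR"
      using pos by (simp_all add: div_less_iff_less_mult mult.commute)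
    then have **: "(a div X, b mod nR) \<in> {..<nL} \<times> {..<nR}" by simp
    show ?thesis
      using g[OF **] * pos by (simp add: f_def f'_def p mixed_digit_less)
  qed
  have "bij_betw f (words (X * Y # ds)) ({..<X * nL} \<times> {..<nR * Y})"
    using f f' by (intro bij_betw_byWitness[where f' = f']) blast+
  then show ?thesis by (simp only: f_def[abs_def])
qed

text \<open>\<open>X\<close> moves as much of the site dimension as possible to the left index. The
  rest \<open>Y\<close> is then coprime to \<open>nL'\<close>, so the product \<open>nL' * Y\<close>
  divides \<open>nR\<close>, which preserves the divisibility as \<open>nL' dvd nR'\<close>.\<close>

lemma gcd_split:
  fixes d nL nR n :: nat
  assumes eq: "d * n = nL * nR" and dvd: "nL dvd nR" and pos: "0 < d" "0 < nL" "0 < nR"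
  obtains X Y nL' nR' where "d = X * Y" "nL = X * nL'" "nR = nR' * Y" "n = nL' * nR'" "nL' dvd nR'"
    "0 < X" "0 < Y" "0 < nL'" "0 < nR'" "X = gcd d nL"
proof -
  define X where "X = gcd d nL"
  have X: "0 < X" using pos by (simp add: X_def)
  obtain Y nL' where d: "d = Y * X" and nL: "nL = nL' * X" and cop: "coprime Y nL'"
    using gcd_coprime_exists[of d nL] X unfolding X_def by blast
  have "X * (Y * n) = X * (nL' * nR)" using eq by (simp add: d nL mult_ac)
  then have *: "Y * n = nL' * nR" using X by simp
  then have "Y dvd nL' * nR" by (metis dvd_triv_left)
  then have "Y dvd nR" using cop by (simp add: coprime_dvd_mult_right_iff)
  moreover have "nL' dvd nR" using dvd nL by (metis dvd_mult_left)
  ultimately have "nL' * Y dvd nR"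
    using cop by (intro divides_mult) (auto simp: ac_simps)
  then obtain t where t: "nR = nL' * Y * t" by (elim dvdE)
  have pos': "0 < Y" "0 < nL'" "0 < t" using pos d nL t by auto
  have "Y * n = Y * (nL' * (nL' * t))" using * t by (simp add: mult_ac)
  then have n: "n = nL' * (nL' * t)" using pos' by simp
  show ?thesis
  proof (rule that[of X Y nL' "nL' * t"])
    show "d = X * Y" "nL = X * nL'" unfolding d nL by (rule mult.commute)+
    show "nR = nL' * t * Y" unfolding t by (simp only: mult_ac)
    show "0 < nL' * t" using pos' by simp
  qed (fact n X pos' X_def dvd_triv_left)+
qed

lemma mixed_digits_less:
  fixes n X :: nat
  assumes "0 < X" "0 < n" "i < X * n * u"
  shows "i mod (X * n) div X < n" "i div (X * n) < u"
  using assms by (simp_all add: div_less_iff_less_mult mult_ac less_mult_imp_div_less)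

text \<open>
  The bond carries the digits of the left index that have not been checked yet together with the
  digits of the right index that have been read so far; the rest of the
  bond index, \<open>i div nL\<close>, is passed through to the right. The divisibility \<open>nL dvd nR\<close> is
  the invariant that keeps the bond dimension below \<open>m\<close>.
\<close>

lemma cluster_tail:
  assumes "prod_list ds = nL * nR" "nL dvd nR" "nR * u = m" "0 < m"
  shows "\<exists>As \<alpha> \<beta>. length As = length ds \<and> (\<forall>A\<in>set As. \<forall>x. A x \<in> carrier_mat m m) \<and>
    bij_betw (\<lambda>s. (\<alpha> s, \<beta> s)) (words ds) ({..<nL} \<times> {..<nR}) \<and>
    (\<forall>s\<in>words ds. mprod m (map2 (\<lambda>A x. A x) As s) = Matrix.mat m m
      (\<lambda>(i, j). if i < nL * u \<and> i mod nL = \<alpha> s \<and> j = \<beta> s + nR * (i div nL) then 1 else 0))"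
  using assms
proof (induction ds arbitrary: nL nR u)
  case Nil
  then have "nL = 1" "nR = 1" "u = m" by auto
  then show ?case
    by (intro exI[of _ "[]"] exI[of _ "\<lambda>_. 0"]) (auto simp: bij_betw_def intro!: eq_matI)
next
  case (Cons d ds)
  have nR: "0 < nR" using Cons.prems by auto
  with Cons.prems(2) have nL: "0 < nL" by (auto intro: Nat.gr0I)
  have eq: "d * prod_list ds = nL * nR" using Cons.prems by simp
  with nL nR have d: "0 < d" by (auto intro: Nat.gr0I)
  obtain X Y nL' nR' where g: "d = X * Y" "nL = X * nL'" "nR = nR' * Y"
    "prod_list ds = nL' * nR'" "nL' dvd nR'" "0 < X" "0 < Y" "0 < nL'" "0 < nR'" and gX: "X = gcd d nL"
    by (rule gcd_split[OF eq Cons.prems(2) d nL nR])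
  \<comment> \<open>The right digit read at this site joins the part that is passed through, so
    \<open>u\<close> grows to \<open>u * Y\<close>.\<close>
  have m': "nR' * (u * Y) = m" using Cons.prems(3) g by (simp add: mult_ac)
  obtain As \<alpha> \<beta> where IH: "length As = length ds" "\<forall>A\<in>set As. \<forall>x. A x \<in> carrier_mat m m"
    "bij_betw (\<lambda>s. (\<alpha> s, \<beta> s)) (words ds) ({..<nL'} \<times> {..<nR'})"
    "\<forall>s\<in>words ds. mprod m (map2 (\<lambda>A x. A x) As s) = Matrix.mat m m
      (\<lambda>(i, j). if i < nL' * (u * Y) \<and> i mod nL' = \<alpha> s \<and> j = \<beta> s + nR' * (i div nL') then 1 else 0)"
    using Cons.IH[OF g(4,5) m' Cons.prems(4)] by blast
  \<comment> \<open>The lowest digit of the left index is checked against \<open>x mod X\<close> and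
    dropped; \<open>x div X\<close> is inserted between the rest of the left index and the carried
    part \<open>i div nL\<close>.\<close>
  define f where "f x i = (if i < nL * u \<and> i mod nL mod X = x mod X
    then Some (i mod nL div X + nL' * (x div X + Y * (i div nL))) else None)" for x i
  define A where "A x = row_map_mat m (\<lambda>_. 1) (f x)" for x
  define \<alpha>' where "\<alpha>' s = hd s mod X + X * \<alpha> (tl s)" for s
  define \<beta>' where "\<beta>' s = \<beta> (tl s) + nR' * (hd s div X)" for s
  have "bij_betw (\<lambda>s. (\<alpha>' s, \<beta>' s)) (words (d # ds)) ({..<nL} \<times> {..<nR})"
    unfolding \<alpha>'_def \<beta>'_def g(1-3) using IH(3) g by (intro bij_betw_words_Cons)
  moreover have "mprod m (map2 (\<lambda>A x. A x) (A # As) w) = Matrix.mat m m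
      (\<lambda>(i, j). if i < nL * u \<and> i mod nL = \<alpha>' w \<and> j = \<beta>' w + nR * (i div nL) then 1 else 0)"
    (is "_ = ?rhs") if w: "w \<in> words (d # ds)" for w
  proof -
    obtain x s where xs: "w = x # s" "x < d" "s \<in> words ds" using w by (rule words_ConsE)
    have x: "x div X < Y" using xs g by (simp add: div_less_iff_less_mult mult.commute)
    let ?R = "Matrix.mat m m
      (\<lambda>(i, j). if i < nL' * (u * Y) \<and> i mod nL' = \<alpha> s \<and> j = \<beta> s + nR' * (i div nL') then 1 else 0 :: complex)"
    have "mprod m (map2 (\<lambda>A x. A x) (A # As) w) = A x * ?R"
      using IH(4) xs by simp
    also have "A x * ?R = ?rhs"
    proof (rule eq_matI)
      fix i j assume "i < dim_row ?rhs" "j < dim_col ?rhs"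
      then have ij: "i < m" "j < m" by auto
      have k: "i mod nL div X < nL'"
        "x div X + Y * (i div nL) < Y * u" if "i < nL * u"
        using mixed_digits_less[of X nL' i u] that g x by (auto intro!: mixed_digit_less)
      have km: "i mod nL div X + nL' * (x div X + Y * (i div nL)) < nL' * (u * Y)" if "i < nL * u"
        using mixed_digit_less[OF k[OF that]] by (simp add: mult_ac)
      \<comment> \<open>The invariant enters here: \<open>nL' \<le> nR'\<close> keeps the new bond
        index below \<open>nR' * (u * Y) = m\<close>.\<close>
      have "nL' * (u * Y) \<le> m"
        using mult_le_mono1[OF dvd_imp_le[OF g(5) g(9)], of "u * Y"] m' by simp
      note km' = less_le_trans[OF km this]
      have "(A x * ?R) $$ (i, j) = (case f x i of None \<Rightarrow> 0 | Some k \<Rightarrow> 1 * ?R $$ (k, j))"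
        unfolding A_def using ij km' by (intro row_map_mat_mult) (auto simp: f_def split: if_splits)
      also have "\<dots> = ?rhs $$ (i, j)"
      proof (cases "i < nL * u \<and> i mod nL mod X = x mod X")
        case True
        define k where "k = i mod nL div X + nL' * (x div X + Y * (i div nL))"
        have kk: "k mod nL' = i mod nL div X" "k div nL' = x div X + Y * (i div nL)"
          using mod_div_digit[OF k(1)] True by (auto simp: k_def)
        have k2: "k < nL' * (u * Y)" "k < m" using km km' True by (auto simp: k_def)
        have "i mod nL = \<alpha>' w \<longleftrightarrow> i mod nL div X = \<alpha> s"
          using digits_eq_iff[of "x mod X" X "i mod nL" "\<alpha> s"] True g(6) by (simp add: \<alpha>'_def xs)
        moreover have "\<beta> s + nR' * (k div nL') = \<beta>' w + nR * (i div nL)"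
          by (simp add: kk \<beta>'_def xs g(3) algebra_simps)
        moreover have "f x i = Some k" using True by (simp add: f_def k_def)
        ultimately show ?thesis
          using True ij k2 kk by simp
      next
        case False
        have "\<not> (i < nL * u \<and> i mod nL = \<alpha>' w)"
          using False g by (auto simp: \<alpha>'_def xs)
        then show ?thesis using False ij by (auto simp: f_def)
      qed
      finally show "(A x * ?R) $$ (i, j) = ?rhs $$ (i, j)" .
    qed (simp_all add: A_def row_map_mat_def)
    finally show ?thesis .
  qed
  ultimately show ?case
    using IH(1,2) by (intro exI[of _ "A # As"] exI[of _ \<alpha>'] exI[of _ \<beta>']) (auto simp: A_def)
qed

text \<open>
  As long as the site dimensions divide the unread part \<open>nL\<close> of the left index, that index is only
  checked and stays on the bond in full. The first site \<open>d\<close> that does not divide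
  \<open>nL\<close> produces a nontrivial digit of the right index; the class \<open>Q\<close> is defined by this digit, and
  the weight can be inserted there because the full left index is still at hand.
\<close>

lemma cluster_head:
  assumes "prod_list ds = nL * m" "c * nL = m" "1 < m"
  shows "\<exists>\<alpha> \<beta> Q. bij_betw (\<lambda>s. (\<alpha> s, \<beta> s)) (words ds) ({..<nL} \<times> {..<m}) \<and>
    (\<forall>z. \<exists>b<m. Q b = z) \<and>
    (\<forall>P w. \<exists>As. length As = length ds \<and> (\<forall>A\<in>set As. \<forall>x. A x \<in> carrier_mat m m) \<and>
      (\<forall>s\<in>words ds. mprod m (map2 (\<lambda>A x. A x) As s) = Matrix.mat m m
        (\<lambda>(i, j). if i div c = \<alpha> s \<and> j = \<beta> s then w (P i :: bool) (Q j :: bool) else 0)))"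
  using assms
proof (induction ds arbitrary: nL c)
  \<comment> \<open>Impossible, as the empty product 1 would equal \<open>nL * m\<close> with
    \<open>m > 1\<close>. Hence some site dimension must fail to divide the unread part.\<close>
  case Nil
  then show ?case by auto
next
  case (Cons d ds)
  have pos: "0 < c" "0 < nL" using Cons.prems by (auto intro: Nat.gr0I)
  have eq: "d * prod_list ds = nL * m" using Cons.prems by simp
  then have d: "0 < d" using pos Cons.prems(3) by (auto intro: Nat.gr0I)
  show ?case
  proof (cases "d dvd nL")
    case True
    then obtain nL' where nL': "nL = d * nL'" by (elim dvdE)
    have "prod_list ds = nL' * m" using eq d by (simp add: nL' mult.assoc)
    moreover have "(c * d) * nL' = m" using Cons.prems(2) by (simp add: nL')
    ultimately obtain \<alpha> \<beta> Q where IH: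
      "bij_betw (\<lambda>s. (\<alpha> s, \<beta> s)) (words ds) ({..<nL'} \<times> {..<m})" "\<forall>z. \<exists>b<m. Q b = z"
      "\<forall>P w. \<exists>As. length As = length ds \<and> (\<forall>A\<in>set As. \<forall>x. A x \<in> carrier_mat m m) \<and>
        (\<forall>s\<in>words ds. mprod m (map2 (\<lambda>A x. A x) As s) = Matrix.mat m m
        (\<lambda>(i, j). if i div (c * d) = \<alpha> s \<and> j = \<beta> s then w (P i :: bool) (Q j :: bool) else 0))"
      using Cons.IH[of nL' "c * d"] Cons.prems(3) by blast
    define \<alpha>' where "\<alpha>' s = hd s mod d + d * \<alpha> (tl s)" for s
    \<comment> \<open>On words \<open>hd s div d\<close> is 0; the term is kept to match
      \<open>bij_betw_words_Cons\<close> with \<open>Y = 1\<close>.\<close>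
    define \<beta>' where "\<beta>' s = \<beta> (tl s) + m * (hd s div d)" for s
    have bij: "bij_betw (\<lambda>s. (\<alpha>' s, \<beta>' s)) (words (d # ds)) ({..<nL} \<times> {..<m})"
      using bij_betw_words_Cons[OF IH(1), of d 1] d Cons.prems(3) by (simp add: \<alpha>'_def \<beta>'_def nL')
    have "\<exists>As. length As = length (d # ds) \<and> (\<forall>A\<in>set As. \<forall>x. A x \<in> carrier_mat m m) \<and>
        (\<forall>s\<in>words (d # ds). mprod m (map2 (\<lambda>A x. A x) As s) = Matrix.mat m m
        (\<lambda>(i, j). if i div c = \<alpha>' s \<and> j = \<beta>' s then w (P i) (Q j) else 0))" for P :: "nat \<Rightarrow> bool" and w :: "bool \<Rightarrow> bool \<Rightarrow> complex"
    proof -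
      obtain As where As: "length As = length ds" "\<forall>A\<in>set As. \<forall>x. A x \<in> carrier_mat m m"
        "\<forall>s\<in>words ds. mprod m (map2 (\<lambda>A x. A x) As s) = Matrix.mat m m
        (\<lambda>(i, j). if i div (c * d) = \<alpha> s \<and> j = \<beta> s then w (P i) (Q j) else 0)"
        using spec[OF spec[OF IH(3), of P], of w] by (elim exE conjE)
      \<comment> \<open>The whole label is a left digit, and the bond index is passed on unchanged;
        dividing by \<open>c\<close> skips the digits already checked.\<close>
      define f where "f x i = (if i div c mod d = x then Some i else None)" for x i :: nat
      define A where "A x = row_map_mat m (\<lambda>_. 1) (f x)" for x
      have "mprod m (map2 (\<lambda>A x. A x) (A # As) v) = Matrix.mat m m
        (\<lambda>(i, j). if i div c = \<alpha>' v \<and> j = \<beta>' v then w (P i) (Q j) else 0)"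
        (is "_ = ?rhs") if v: "v \<in> words (d # ds)" for v
      proof -
        obtain x s where xs: "v = x # s" "x < d" "s \<in> words ds" using v by (rule words_ConsE)
        let ?R = "Matrix.mat m m
          (\<lambda>(i, j). if i div (c * d) = \<alpha> s \<and> j = \<beta> s then w (P i) (Q j) else 0)"
        have "mprod m (map2 (\<lambda>A x. A x) (A # As) v) = A x * ?R"
          using As(3) xs by simp
        also have "A x * ?R = ?rhs"
        proof (rule eq_matI)
          fix i j assume "i < dim_row ?rhs" "j < dim_col ?rhs"
          then have ij: "i < m" "j < m" by auto
          have "(A x * ?R) $$ (i, j) = (case f x i of None \<Rightarrow> 0 | Some k \<Rightarrow> 1 * ?R $$ (k, j))"
            unfolding A_def using ij by (intro row_map_mat_mult) (auto simp: f_def split: if_splits)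
          moreover have "i div c = \<alpha>' v \<longleftrightarrow> i div c mod d = x \<and> i div (c * d) = \<alpha> s"
            using digits_eq_iff[of x d "i div c" "\<alpha> s"] xs by (simp add: \<alpha>'_def div_mult2_eq)
          moreover have "\<beta>' v = \<beta> s" using xs by (simp add: \<beta>'_def)
          ultimately show "(A x * ?R) $$ (i, j) = ?rhs $$ (i, j)"
            using ij by (auto simp: f_def)
        qed (simp_all add: A_def row_map_mat_def)
        finally show ?thesis .
      qed
      then show ?thesis
        using As(1,2) by (intro exI[of _ "A # As"]) (auto simp: A_def)
    qed
    with bij IH(2) show ?thesis by blast
  next
    case False
    have dvd: "nL dvd m" and mpos: "0 < m" using Cons.prems(2,3) by auto
    obtain X Y nL' nR' where g: "d = X * Y" "nL = X * nL'" "m = nR' * Y"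
      "prod_list ds = nL' * nR'" "nL' dvd nR'" "0 < X" "0 < Y" "0 < nL'" "0 < nR'" and gX: "X = gcd d nL"
      by (rule gcd_split[OF eq dvd d pos(2) mpos])
    \<comment> \<open>The right digit is nontrivial because \<open>d\<close> does not divide
      \<open>nL\<close>; this makes both classes of \<open>Q\<close> nonempty.\<close>
    have Y: "1 < Y"
    proof (rule ccontr)
      assume "\<not> 1 < Y"
      with g(7) have "Y = 1" by simp
      with g(1) gX have "d = gcd d nL" by simp
      with False show False by (metis gcd_dvd2)
    qed
    \<comment> \<open>The remaining sites are handled with \<open>u = Y\<close>: the right digit
      read here is all that is passed through.\<close>
    obtain As \<alpha> \<beta> where tail: "length As = length ds" "\<forall>A\<in>set As. \<forall>x. A x \<in> carrier_mat m m"
      "bij_betw (\<lambda>s. (\<alpha> s, \<beta> s)) (words ds) ({..<nL'} \<times> {..<nR'})"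
      "\<forall>s\<in>words ds. mprod m (map2 (\<lambda>A x. A x) As s) = Matrix.mat m m
        (\<lambda>(i, j). if i < nL' * Y \<and> i mod nL' = \<alpha> s \<and> j = \<beta> s + nR' * (i div nL') then 1 else 0)"
      using cluster_tail[OF g(4,5) g(3)[symmetric]] Cons.prems(3) by auto
    define \<alpha>' where "\<alpha>' s = hd s mod X + X * \<alpha> (tl s)" for s
    define \<beta>' where "\<beta>' s = \<beta> (tl s) + nR' * (hd s div X)" for s
    \<comment> \<open>\<open>b div nR'\<close> is the digit of the right index supplied by this
      site, so its label alone determines the class.\<close>
    define Q where "Q b \<longleftrightarrow> b div nR' = 0" for b
    have bij: "bij_betw (\<lambda>s. (\<alpha>' s, \<beta>' s)) (words (d # ds)) ({..<nL} \<times> {..<m})"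
      unfolding \<alpha>'_def \<beta>'_def g(1-3) using tail(3) g by (intro bij_betw_words_Cons)
    have Q: "\<exists>b<m. Q b = z" for z
    proof -
      have "Q 0" "\<not> Q nR'" "nR' < m" using g(3,9) Y by (simp_all add: Q_def)
      then show ?thesis using mpos by (intro exI[of _ "if z then 0 else nR'"]) simp
    qed
    have "\<exists>As. length As = length (d # ds) \<and> (\<forall>A\<in>set As. \<forall>x. A x \<in> carrier_mat m m) \<and>
        (\<forall>s\<in>words (d # ds). mprod m (map2 (\<lambda>A x. A x) As s) = Matrix.mat m m
        (\<lambda>(i, j). if i div c = \<alpha>' s \<and> j = \<beta>' s then w (P i) (Q j) else 0))" for P :: "nat \<Rightarrow> bool" and w :: "bool \<Rightarrow> bool \<Rightarrow> complex"
    proof -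
      define f where "f x i = (if i div c mod X = x mod X
        then Some (i div c div X + nL' * (x div X)) else None)" for x i
      \<comment> \<open>The row index is still the full left index and the label determines the
        right class, so the whole weight \<open>w (P i) (Q j)\<close> can be applied at this
        site.\<close>
      define A where "A x = row_map_mat m (\<lambda>i. w (P i) (x div X = 0)) (f x)" for x
      have "mprod m (map2 (\<lambda>A x. A x) (A # As) v) = Matrix.mat m m
        (\<lambda>(i, j). if i div c = \<alpha>' v \<and> j = \<beta>' v then w (P i) (Q j) else 0)"
        (is "_ = ?rhs") if v: "v \<in> words (d # ds)" for v
      proof -
        obtain x s where xs: "v = x # s" "x < d" "s \<in> words ds" using v by (rule words_ConsE)
        have x: "x div X < Y" using xs g by (simp add: div_less_iff_less_mult mult.commute)
        have \<beta>: "\<beta> s < nR'" using bij_betwE[OF tail(3)] xs by auto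
        let ?R = "Matrix.mat m m
          (\<lambda>(i, j). if i < nL' * Y \<and> i mod nL' = \<alpha> s \<and> j = \<beta> s + nR' * (i div nL') then 1 else 0 :: complex)"
        have "mprod m (map2 (\<lambda>A x. A x) (A # As) v) = A x * ?R"
          using tail(4) xs by simp
        also have "A x * ?R = ?rhs"
        proof (rule eq_matI)
          fix i j assume "i < dim_row ?rhs" "j < dim_col ?rhs"
          then have ij: "i < m" "j < m" by auto
          define k where "k = i div c div X + nL' * (x div X)"
          have "i div c < nL"
            using ij Cons.prems(2) pos by (simp add: div_less_iff_less_mult mult.commute)
          then have *: "i div c div X < nL'"
            using g by (simp add: div_less_iff_less_mult mult.commute)
          then have k: "k mod nL' = i div c div X" "k div nL' = x div X" "k < nL' * Y"
            using mod_div_digit[OF *] mixed_digit_less[OF * x] by (auto simp: k_def)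
          have "nL' * Y \<le> m"
            using mult_le_mono1[OF dvd_imp_le[OF g(5) g(9)], of Y] g(3) by simp
          then have km: "k < m" using k by simp
          have "(A x * ?R) $$ (i, j) = (case f x i of None \<Rightarrow> 0 | Some k \<Rightarrow> w (P i) (x div X = 0) * ?R $$ (k, j))"
            unfolding A_def using ij km
            by (intro row_map_mat_mult) (auto simp: f_def k_def split: if_splits)
          moreover have "i div c = \<alpha>' v \<longleftrightarrow> i div c mod X = x mod X \<and> i div c div X = \<alpha> s"
            using digits_eq_iff[of "x mod X" X "i div c" "\<alpha> s"] g(6) by (simp add: \<alpha>'_def xs)
          moreover have "\<beta>' v = \<beta> s + nR' * (x div X)" by (simp add: \<beta>'_def xs)
          moreover have "f x i = (if i div c mod X = x mod X then Some k else None)"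
            by (simp add: f_def k_def)
          moreover have "Q (\<beta> s + nR' * (x div X)) \<longleftrightarrow> x div X = 0"
            using mod_div_digit[OF \<beta>, of "x div X"] by (simp add: Q_def)
          ultimately show "(A x * ?R) $$ (i, j) = ?rhs $$ (i, j)"
            using ij k km by simp
        qed (simp_all add: A_def row_map_mat_def)
        finally show ?thesis .
      qed
      then show ?thesis
        using tail(1,2) by (intro exI[of _ "A # As"]) (auto simp: A_def)
    qed
    with bij Q show ?thesis by blast
  qed
qed

section \<open>States on the ring\<close>

lemma mprod_zero:
  "set Ms \<subseteq> carrier_mat m m \<Longrightarrow> 0\<^sub>m m m \<in> set Ms \<Longrightarrow> mprod m Ms = 0\<^sub>m m m"
proof (induction Ms)
  case (Cons M Ms)
  then have "mprod m Ms \<in> carrier_mat m m" by (intro mprod_carrier) auto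
  then show ?case using Cons by auto
qed simp

text \<open>A scaled matrix unit. The scalar is a parameter so that a product of units with
  mismatched indices keeps this form, with scalar 0.\<close>

definition munit :: "nat \<Rightarrow> nat \<Rightarrow> nat \<Rightarrow> complex \<Rightarrow> complex mat" where
  "munit m a b v = Matrix.mat m m (\<lambda>(i, j). if i = a \<and> j = b then v else 0)"

lemma munit_carrier [simp]: "munit m a b v \<in> carrier_mat m m"
  by (simp add: munit_def)

lemma munit_mult:
  assumes "b < m"
  shows "munit m a b v * munit m a' b' v' = munit m a b' (if b = a' then v * v' else 0)"
proof (rule eq_matI)
  fix i j assume "i < dim_row (munit m a b' (if b = a' then v * v' else 0))"
    "j < dim_col (munit m a b' (if b = a' then v * v' else 0))"
  then have ij: "i < m" "j < m" by (auto simp: munit_def)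
  have "(munit m a b v * munit m a' b' v') $$ (i, j) =
      (\<Sum>k<m. (if i = a \<and> k = b then v else 0) * (if k = a' \<and> j = b' then v' else 0))"
    using ij by (auto simp: munit_def scalar_prod_def atLeast0LessThan intro!: sum.cong)
  also have "\<dots> = (\<Sum>k<m. if k = b then (if i = a \<and> b = a' \<and> j = b' then v * v' else 0) else 0)"
    by (intro sum.cong) auto
  also have "\<dots> = munit m a b' (if b = a' then v * v' else 0) $$ (i, j)"
    using assms ij by (auto simp: munit_def)
  finally show "(munit m a b v * munit m a' b' v') $$ (i, j) =
      munit m a b' (if b = a' then v * v' else 0) $$ (i, j)" .
qed (simp_all add: munit_def)

lemma mat_trace_munit:
  assumes "a < m"
  shows "mat_trace (munit m a b v) = (if a = b then v else 0)"
proof -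
  have "mat_trace (munit m a b v) = (\<Sum>i<m. if i = a then (if a = b then v else 0) else 0)"
    unfolding mat_trace_def munit_def by (intro sum.cong) auto
  then show ?thesis using assms by simp
qed

lemma mprod_munits:
  assumes "\<And>c. c < Suc n \<Longrightarrow> a c < m \<and> b c < m"
  shows "mprod m (map (\<lambda>c. munit m (a c) (b c) (v c)) [0..<Suc n]) =
    munit m (a 0) (b n) (if \<forall>c<n. b c = a (Suc c) then \<Prod>c<Suc n. v c else 0)"
  using assms
proof (induction n)
  case 0
  have "munit m (a 0) (b 0) (v 0) * 1\<^sub>m m = munit m (a 0) (b 0) (v 0)"
    by (rule right_mult_one_mat) (rule munit_carrier)
  then show ?case by simp
next
  case (Suc n)
  let ?F = "\<lambda>c. munit m (a c) (b c) (v c)"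
  have split: "[0..<Suc (Suc n)] = [0..<Suc n] @ [Suc n]" by simp
  have "mprod m (map ?F [0..<Suc (Suc n)]) = mprod m (map ?F [0..<Suc n]) * mprod m (map ?F [Suc n])"
    unfolding split map_append by (intro mprod_append) auto
  also have "mprod m (map ?F [Suc n]) = ?F (Suc n)"
    by (simp add: right_mult_one_mat[OF munit_carrier])
  also have "mprod m (map ?F [0..<Suc n]) =
      munit m (a 0) (b n) (if \<forall>c<n. b c = a (Suc c) then \<Prod>c<Suc n. v c else 0)"
    using Suc by (metis less_SucI)
  also have "\<dots> * ?F (Suc n) = munit m (a 0) (b (Suc n))
      (if b n = a (Suc n) then (if \<forall>c<n. b c = a (Suc c) then \<Prod>c<Suc n. v c else 0) * v (Suc n) else 0)"
    using Suc.prems by (intro munit_mult) simp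
  also have "(if b n = a (Suc n) then (if \<forall>c<n. b c = a (Suc c) then \<Prod>c<Suc n. v c else 0) * v (Suc n) else 0)
      = (if \<forall>c<Suc n. b c = a (Suc c) then \<Prod>c<Suc (Suc n). v c else 0)"
    by (auto simp: less_Suc_eq)
  finally show ?case .
qed

lemma mat_trace_mprod_munits:
  assumes "0 < K" "\<And>c. c < K \<Longrightarrow> a c < m \<and> b c < m"
  shows "mat_trace (mprod m (map (\<lambda>c. munit m (a c) (b c) (v c)) [0..<K])) =
    (if \<forall>c<K. b c = a (Suc c mod K) then \<Prod>c<K. v c else 0)"
proof -
  obtain n where K: "K = Suc n" using assms(1) by (cases K) auto
  have "(\<forall>c<Suc n. b c = a (Suc c mod Suc n)) \<longleftrightarrow> (\<forall>c<n. b c = a (Suc c)) \<and> a 0 = b n"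
    by (auto simp: All_less_Suc)
  then show ?thesis
    using assms(2)[of 0] assms(2) unfolding K by (subst mprod_munits) (auto simp: mat_trace_munit)
qed

section \<open>Parity of class changes and the weights they carry\<close>

lemma odd_card_changes:
  "odd (card {c\<in>{1..<n}. t c \<noteq> t (Suc c)}) \<longleftrightarrow> t 1 \<noteq> (t n :: bool)" if "1 \<le> n"
  using that
proof (induction n rule: dec_induct)
  case (step n)
  have "{c\<in>{1..<Suc n}. t c \<noteq> t (Suc c)} =
      {c\<in>{1..<n}. t c \<noteq> t (Suc c)} \<union> (if t n \<noteq> t (Suc n) then {n} else {})"
    using step by (auto simp: less_Suc_eq)
  then have "card {c\<in>{1..<Suc n}. t c \<noteq> t (Suc c)} =
      card {c\<in>{1..<n}. t c \<noteq> t (Suc c)} + (if t n \<noteq> t (Suc n) then 1 else 0)"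
    by (simp add: card_insert_if)
  then show ?case using step by auto
qed simp

text \<open>The clusters from 1 to \<open>K - 1\<close> lead from bond 1 around the ring to bond 0,
  and every change toggles the class; the count is odd iff the ends of this path differ.\<close>

lemma odd_flips:
  assumes "2 \<le> K"
  shows "odd (flips K t) \<longleftrightarrow> t 0 \<noteq> t 1"
proof -
  \<comment> \<open>Writing \<open>c mod K\<close> lets position \<open>K\<close> of the path stand
    for bond 0.\<close>
  have "{c\<in>{1..<K}. t c \<noteq> t (Suc c mod K)} = {c\<in>{1..<K}. t (c mod K) \<noteq> t (Suc c mod K)}"
    by auto
  then show ?thesis
    using odd_card_changes[of K "\<lambda>c. t (c mod K)"] assms by (auto simp: flips_def)
qed

text \<open>\<open>\<kappa>\<close> is a global factor placed at cluster 0; it later normalises the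
  state.\<close>

definition flip_weight :: "complex \<Rightarrow> complex \<Rightarrow> nat \<Rightarrow> bool \<Rightarrow> bool \<Rightarrow> complex" where
  "flip_weight \<epsilon> \<kappa> c t t' = (if c = 0 then \<kappa> * (if t = t' then 1 else 1 / \<epsilon>) else if t = t' then 1 else \<epsilon>)"

text \<open>When the count is odd, cluster 0 changes class too, and its factor
  \<open>1 / \<epsilon>\<close> cancels one \<open>\<epsilon>\<close>.\<close>

lemma prod_flip_weight:
  assumes K: "2 \<le> K" and "\<epsilon> \<noteq> 0"
  shows "(\<Prod>c<K. flip_weight \<epsilon> \<kappa> c (t c) (t (Suc c mod K))) =
    \<kappa> * \<epsilon> ^ (if odd (flips K t) then flips K t - 1 else flips K t)"
proof -
  have "{..<K} = insert 0 {1..<K}" using K by auto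
  then have "(\<Prod>c<K. flip_weight \<epsilon> \<kappa> c (t c) (t (Suc c mod K))) =
      flip_weight \<epsilon> \<kappa> 0 (t 0) (t 1) * (\<Prod>c\<in>{1..<K}. flip_weight \<epsilon> \<kappa> c (t c) (t (Suc c mod K)))"
    using K by simp
  also have "(\<Prod>c\<in>{1..<K}. flip_weight \<epsilon> \<kappa> c (t c) (t (Suc c mod K))) =
      (\<Prod>c\<in>{1..<K}. if t c \<noteq> t (Suc c mod K) then \<epsilon> else 1)"
    by (intro prod.cong) (auto simp: flip_weight_def)
  also have "\<dots> = \<epsilon> ^ flips K t"
    by (simp add: prod.inter_filter[symmetric] flips_def)
  finally show ?thesis
    using assms odd_flips[OF K, of t] by (cases "flips K t") (auto simp: flip_weight_def)
qed

text \<open>A word encodes a pair of bond indices. The class \<open>Q\<close> of the right index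
  comes with the cluster, whereas \<open>P\<close> and \<open>w\<close> are quantified: the class of
  the left index is imposed by the neighbour, and the weights vary with
  \<open>\<epsilon>\<close>.\<close>

definition splits_cluster ::
  "nat \<Rightarrow> nat list \<Rightarrow> (nat list \<Rightarrow> nat) \<Rightarrow> (nat list \<Rightarrow> nat) \<Rightarrow> (nat \<Rightarrow> bool) \<Rightarrow> bool" where
  "splits_cluster m ds \<alpha> \<beta> Q \<longleftrightarrow> bij_betw (\<lambda>s. (\<alpha> s, \<beta> s)) (words ds) ({..<m} \<times> {..<m}) \<and>
    (\<forall>z. \<exists>b<m. Q b = z) \<and>
    (\<forall>P w. \<exists>As. length As = length ds \<and> (\<forall>A\<in>set As. \<forall>x. A x \<in> carrier_mat m m) \<and>
      (\<forall>s\<in>words ds. mprod m (map2 (\<lambda>A x. A x) As s) =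
        munit m (\<alpha> s) (\<beta> s) (w (P (\<alpha> s) :: bool) (Q (\<beta> s) :: bool))))"

lemma exists_splits_cluster:
  assumes "prod_list ds = m\<^sup>2" "1 < m"
  shows "\<exists>\<alpha> \<beta> Q. splits_cluster m ds \<alpha> \<beta> Q"
proof -
  have eq: "Matrix.mat m m (\<lambda>(i, j). if i div 1 = a \<and> j = b then w (P i) (Q j) else 0) =
      munit m a b (w (P a) (Q b))" for a b P Q and w :: "bool \<Rightarrow> bool \<Rightarrow> complex"
    by (rule eq_matI) (auto simp: munit_def)
  \<comment> \<open>No digit has been checked at the outset, so the construction starts with
    \<open>nL = m\<close> and \<open>c = 1\<close>.\<close>
  show ?thesis
    using cluster_head[of ds m m 1] assms unfolding eq splits_cluster_def
    by (simp add: power2_eq_square)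
qed

section \<open>Clusters of consecutive sites on the ring\<close>

lemma concat_map_offsets:
  "concat (map (\<lambda>c. map (\<lambda>i. f ((\<Sum>b<c. len b) + i)) [0..<len c]) [0..<K]) =
    map f [0..<(\<Sum>b<K. len b :: nat)]"
proof (induction K)
  case (Suc K)
  have "map (\<lambda>i. f ((\<Sum>b<K. len b) + i)) [0..<len K] = map f [(\<Sum>b<K. len b)..<(\<Sum>b<K. len b) + len K]"
    by (intro nth_equalityI) auto
  then show ?case using Suc by (simp add: upt_add_eq_append[of 0])
qed simp

text \<open>The offset \<open>r\<close> lets cluster 0 begin anywhere, so a cluster may run past
  site \<open>N - 1\<close>. \<open>d c i\<close> is the number of labels in use at a site, possibly
  smaller than its dimension.\<close>

locale clustered_ring =
  fixes m N K r :: nat and len \<delta> :: "nat \<Rightarrow> nat" and d :: "nat \<Rightarrow> nat \<Rightarrow> nat"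
    and \<alpha> \<beta> :: "nat \<Rightarrow> nat list \<Rightarrow> nat" and Q :: "nat \<Rightarrow> nat \<Rightarrow> bool"
    and pos :: "nat \<Rightarrow> nat \<Rightarrow> nat"
  assumes K: "3 \<le> K" and N: "N = (\<Sum>c<K. len c)" and N_pos: "0 < N"
    and pos_def: "\<And>c i. pos c i = (r + (\<Sum>b<c. len b) + i) mod N"
    and le_\<delta>: "\<And>c i. c < K \<Longrightarrow> i < len c \<Longrightarrow> d c i \<le> \<delta> (pos c i)"
    and splits: "\<And>c. c < K \<Longrightarrow> splits_cluster m (map (d c) [0..<len c]) (\<alpha> c) (\<beta> c) (Q c)"
begin

lemma concat_pos: "concat (map (\<lambda>c. map (pos c) [0..<len c]) [0..<K]) = rotate r [0..<N]"
proof -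
  have pos: "pos = (\<lambda>c i. (r + ((\<Sum>b<c. len b) + i)) mod N)"
    by (simp add: pos_def fun_eq_iff add.assoc)
  have "concat (map (\<lambda>c. map (pos c) [0..<len c]) [0..<K]) = map (\<lambda>k. (r + k) mod N) [0..<N]"
    using concat_map_offsets[of "\<lambda>k. (r + k) mod N" len K] unfolding pos N[symmetric] .
  also have "\<dots> = rotate r [0..<N]"
    by (intro nth_equalityI) (auto simp: nth_rotate)
  finally show ?thesis .
qed

lemma bij_pos: "bij_betw (\<lambda>(c, i). pos c i) (SIGMA c:{..<K}. {..<len c}) {..<N}"
proof -
  have "{..<N} = set (concat (map (\<lambda>c. map (pos c) [0..<len c]) [0..<K]))"
    by (simp add: concat_pos atLeast0LessThan)
  also have "\<dots> = (\<Union>c\<in>{..<K}. pos c ` {..<len c})"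
    by (simp add: atLeast0LessThan image_image)
  also have "\<dots> = (\<lambda>(c, i). pos c i) ` (SIGMA c:{..<K}. {..<len c})"
    by auto
  finally have img: "(\<lambda>(c, i). pos c i) ` (SIGMA c:{..<K}. {..<len c}) = {..<N}" ..
  moreover have "card (SIGMA c:{..<K}. {..<len c}) = card {..<N}" by (simp add: N)
  ultimately show ?thesis
    by (auto simp: bij_betw_def intro!: eq_card_imp_inj_on)
qed

definition coord :: "nat \<Rightarrow> nat \<times> nat" where
  "coord = inv_into (SIGMA c:{..<K}. {..<len c}) (\<lambda>(c, i). pos c i)"

lemma coord_pos: "c < K \<Longrightarrow> i < len c \<Longrightarrow> coord (pos c i) = (c, i)"
  using bij_betw_inv_into_left[OF bij_pos, of "(c, i)"] by (simp add: coord_def)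

lemma pos_less: "c < K \<Longrightarrow> i < len c \<Longrightarrow> pos c i < N"
  using N_pos by (simp add: pos_def)

lemma site_cases:
  assumes "j < N"
  obtains c i where "c < K" "i < len c" "j = pos c i"
proof -
  have "j \<in> (\<lambda>(c, i). pos c i) ` (SIGMA c:{..<K}. {..<len c})"
    using assms bij_pos by (simp add: bij_betw_def)
  then show ?thesis by (auto intro: that)
qed

text \<open>Reading the ring cluster by cluster only rotates the list of site matrices, which leaves
  the trace unchanged.\<close>

lemma mat_trace_blocks:
  assumes "\<And>j. j < N \<Longrightarrow> M j \<in> carrier_mat m m"
  shows "mat_trace (mprod m (map M [0..<N])) =
    mat_trace (mprod m (map (\<lambda>c. mprod m (map (\<lambda>i. M (pos c i)) [0..<len c])) [0..<K]))"
proof -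
  have "mprod m (map (\<lambda>c. mprod m (map (\<lambda>i. M (pos c i)) [0..<len c])) [0..<K]) =
      mprod m (map (mprod m) (map (\<lambda>c. map (\<lambda>i. M (pos c i)) [0..<len c]) [0..<K]))"
    by (simp add: comp_def)
  also have "\<dots> = mprod m (concat (map (\<lambda>c. map (\<lambda>i. M (pos c i)) [0..<len c]) [0..<K]))"
    using assms pos_less by (subst mprod_concat) auto
  also have "concat (map (\<lambda>c. map (\<lambda>i. M (pos c i)) [0..<len c]) [0..<K]) =
      map M (concat (map (\<lambda>c. map (pos c) [0..<len c]) [0..<K]))"
    by (simp add: map_concat comp_def)
  also have "\<dots> = rotate r (map M [0..<N])"
    by (simp add: concat_pos rotate_map)
  finally show ?thesis
    using assms by (simp add: mat_trace_mprod_rotate image_subset_iff)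
qed

section \<open>Configurations and weighted states on the ring\<close>

definition word :: "nat \<Rightarrow> (nat \<Rightarrow> nat) \<Rightarrow> nat list" where
  "word c \<sigma> = map (\<lambda>i. \<sigma> (pos c i)) [0..<len c]"

text \<open>The configurations that can have a nonzero coefficient: only labels in use occur, and
  neighbouring clusters agree on the index of their common bond.\<close>

definition supported :: "(nat \<Rightarrow> nat) \<Rightarrow> bool" where
  "supported \<sigma> \<longleftrightarrow> \<sigma> \<in> configs N \<delta> \<and> (\<forall>c<K. word c \<sigma> \<in> words (map (d c) [0..<len c])) \<and>
    (\<forall>c<K. \<beta> c (word c \<sigma>) = \<alpha> (Suc c mod K) (word (Suc c mod K) \<sigma>))"

text \<open>The class of the left bond of cluster \<open>c\<close> is the one produced by its predecessor.\<close>

definition T :: "nat \<Rightarrow> nat \<Rightarrow> bool" where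
  "T c = Q (if c = 0 then K - 1 else c - 1)"

lemma T_Suc: "c < K \<Longrightarrow> T (Suc c mod K) = Q c"
  by (cases "Suc c = K") (auto simp: T_def)

definition type_seq :: "(nat \<Rightarrow> nat) \<Rightarrow> nat \<Rightarrow> bool" where
  "type_seq \<sigma> c = T c (\<alpha> c (word c \<sigma>))"

lemma T_surj: "c < K \<Longrightarrow> \<exists>x<m. T c x = z"
  using splits[of "if c = 0 then K - 1 else c - 1"] by (auto simp: splits_cluster_def T_def)

lemma ends_less:
  assumes "c < K" "s \<in> words (map (d c) [0..<len c])"
  shows "\<alpha> c s < m" "\<beta> c s < m"
  using splits[OF assms(1)] assms(2) by (auto simp: splits_cluster_def dest!: bij_betwE)

lemma weighted_state_is_mps:
  fixes w :: "nat \<Rightarrow> bool \<Rightarrow> bool \<Rightarrow> complex"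
  obtains A where "\<And>j s. j < N \<Longrightarrow> A j s \<in> carrier_mat m m"
    "mps N m \<delta> A = (\<lambda>\<sigma>. if supported \<sigma>
      then \<Prod>c<K. w c (type_seq \<sigma> c) (type_seq \<sigma> (Suc c mod K)) else 0)"
proof -
  have "\<forall>c. \<exists>As. c < K \<longrightarrow> length As = len c \<and> (\<forall>A\<in>set As. \<forall>x. A x \<in> carrier_mat m m) \<and>
      (\<forall>s\<in>words (map (d c) [0..<len c]). mprod m (map2 (\<lambda>A x. A x) As s) =
        munit m (\<alpha> c s) (\<beta> c s) (w c (T c (\<alpha> c s)) (Q c (\<beta> c s))))"
  proof (intro allI)
    fix c
    show "\<exists>As. c < K \<longrightarrow> length As = len c \<and> (\<forall>A\<in>set As. \<forall>x. A x \<in> carrier_mat m m) \<and>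
      (\<forall>s\<in>words (map (d c) [0..<len c]). mprod m (map2 (\<lambda>A x. A x) As s) =
        munit m (\<alpha> c s) (\<beta> c s) (w c (T c (\<alpha> c s)) (Q c (\<beta> c s))))"
    proof (cases "c < K")
      case True
      from splits[OF True, unfolded splits_cluster_def]
      have "\<forall>P w. \<exists>As. length As = length (map (d c) [0..<len c]) \<and>
        (\<forall>A\<in>set As. \<forall>x. A x \<in> carrier_mat m m) \<and>
        (\<forall>s\<in>words (map (d c) [0..<len c]). mprod m (map2 (\<lambda>A x. A x) As s) =
        munit m (\<alpha> c s) (\<beta> c s) (w (P (\<alpha> c s) :: bool) (Q c (\<beta> c s) :: bool)))" by blast
      from spec[OF spec[OF this, of "T c"], of "w c"] show ?thesis by simp
    qed simp
  qed
  then obtain As where As: "\<And>c. c < K \<Longrightarrow> length (As c) = len c"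
    "\<And>c A x. c < K \<Longrightarrow> A \<in> set (As c) \<Longrightarrow> A x \<in> carrier_mat m m"
    "\<And>c s. c < K \<Longrightarrow> s \<in> words (map (d c) [0..<len c]) \<Longrightarrow> mprod m (map2 (\<lambda>A x. A x) (As c) s) =
        munit m (\<alpha> c s) (\<beta> c s) (w c (T c (\<alpha> c s)) (Q c (\<beta> c s)))"
    by (drule_tac choice) blast
  \<comment> \<open>Labels that are not in use get the zero matrix, so every coefficient involving
    them vanishes.\<close>
  define A where "A j x = (if x < d (fst (coord j)) (snd (coord j))
    then (As (fst (coord j)) ! snd (coord j)) x else 0\<^sub>m m m)" for j x
  have A_pos: "A (pos c i) x = (if x < d c i then (As c ! i) x else 0\<^sub>m m m)"
    if "c < K" "i < len c" for c i x
    using that by (simp add: A_def coord_pos)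
  have A: "A j x \<in> carrier_mat m m" if "j < N" for j x
    using that by (elim site_cases) (auto simp: A_pos As)
  have "mps N m \<delta> A \<sigma> = (if supported \<sigma>
      then \<Prod>c<K. w c (type_seq \<sigma> c) (type_seq \<sigma> (Suc c mod K)) else 0)" for \<sigma>
  proof (cases "\<sigma> \<in> configs N \<delta>")
    case \<sigma>: True
    have mps: "mps N m \<delta> A \<sigma> = mat_trace (mprod m (map (\<lambda>j. A j (\<sigma> j)) [0..<N]))"
      using \<sigma> by (simp add: mps_def mprod_def)
    show ?thesis
    proof (cases "\<forall>c<K. word c \<sigma> \<in> words (map (d c) [0..<len c])")
      case True
      have blk: "mprod m (map (\<lambda>i. A (pos c i) (\<sigma> (pos c i))) [0..<len c]) =
          munit m (\<alpha> c (word c \<sigma>)) (\<beta> c (word c \<sigma>)) (w c (T c (\<alpha> c (word c \<sigma>))) (Q c (\<beta> c (word c \<sigma>))))"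
        if c: "c < K" for c
      proof -
        have "\<sigma> (pos c i) < d c i" if "i < len c" for i
          using True c that by (auto simp: words_def word_def list_all2_conv_all_nth)
        then have "map (\<lambda>i. A (pos c i) (\<sigma> (pos c i))) [0..<len c] = map2 (\<lambda>A x. A x) (As c) (word c \<sigma>)"
          using c by (intro nth_equalityI) (auto simp: word_def As A_pos)
        then show ?thesis using As(3)[OF c] True c by simp
      qed
      have "mps N m \<delta> A \<sigma> =
          mat_trace (mprod m (map (\<lambda>c. mprod m (map (\<lambda>i. A (pos c i) (\<sigma> (pos c i))) [0..<len c])) [0..<K]))"
        unfolding mps using A by (intro mat_trace_blocks)
      also have "map (\<lambda>c. mprod m (map (\<lambda>i. A (pos c i) (\<sigma> (pos c i))) [0..<len c])) [0..<K] =
        map (\<lambda>c. munit m (\<alpha> c (word c \<sigma>)) (\<beta> c (word c \<sigma>))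
          (w c (T c (\<alpha> c (word c \<sigma>))) (Q c (\<beta> c (word c \<sigma>))))) [0..<K]"
        using blk by simp
      also have "mat_trace (mprod m \<dots>) =
        (if \<forall>c<K. \<beta> c (word c \<sigma>) = \<alpha> (Suc c mod K) (word (Suc c mod K) \<sigma>)
         then \<Prod>c<K. w c (T c (\<alpha> c (word c \<sigma>))) (Q c (\<beta> c (word c \<sigma>))) else 0)"
        using K True ends_less by (intro mat_trace_mprod_munits) auto
      also have "\<dots> = (if supported \<sigma> then \<Prod>c<K. w c (type_seq \<sigma> c) (type_seq \<sigma> (Suc c mod K)) else 0)"
        using True \<sigma> by (auto simp: supported_def type_seq_def T_Suc intro!: prod.cong)
      finally show ?thesis .
    next
      case False
      then obtain c i where ci: "c < K" "i < len c" "\<not> \<sigma> (pos c i) < d c i"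
        by (auto simp: words_def word_def list_all2_conv_all_nth)
      then have "A (pos c i) (\<sigma> (pos c i)) = 0\<^sub>m m m" by (simp add: A_pos)
      then have "0\<^sub>m m m \<in> set (map (\<lambda>j. A j (\<sigma> j)) [0..<N])"
        using pos_less[OF ci(1,2)] by (force simp: image_iff)
      then have "mprod m (map (\<lambda>j. A j (\<sigma> j)) [0..<N]) = 0\<^sub>m m m"
        using A by (intro mprod_zero) auto
      moreover have "\<not> supported \<sigma>" using False by (auto simp: supported_def)
      ultimately show ?thesis by (simp add: mps mat_trace_def)
    qed
  qed (simp add: mps_def supported_def)
  then show ?thesis using A by (intro that[of A]) auto
qed

text \<open>The clusters occupy disjoint sets of sites, so a word can be prescribed for each of them
  independently.\<close>

lemma exists_config:
  assumes ab: "\<And>c. c < K \<Longrightarrow> a c < m \<and> b c < m"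
    and enc: "\<And>c x y. c < K \<Longrightarrow> x < m \<Longrightarrow> y < m \<Longrightarrow> enc c x y \<in> words (map (d c) [0..<len c])"
  shows "\<exists>\<sigma>\<in>configs N \<delta>. (\<forall>c<K. \<forall>i<len c. \<sigma> (pos c i) = enc c (a c) (b c) ! i) \<and>
    (\<forall>c<K. word c \<sigma> = enc c (a c) (b c))"
proof -
  define \<sigma> where "\<sigma> = (\<lambda>j\<in>{..<N}. case coord j of (c, i) \<Rightarrow> enc c (a c) (b c) ! i)"
  have \<sigma>_pos: "\<sigma> (pos c i) = enc c (a c) (b c) ! i" if "c < K" "i < len c" for c i
    using that pos_less[OF that] by (simp add: \<sigma>_def coord_pos)
  have enc': "length (enc c (a c) (b c)) = len c" "\<And>i. i < len c \<Longrightarrow> enc c (a c) (b c) ! i < d c i"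
    if "c < K" for c
    using enc[OF that, of "a c" "b c"] ab[OF that] by (auto simp: words_def list_all2_conv_all_nth)
  have "\<sigma> j < \<delta> j" if j: "j < N" for j
  proof -
    obtain c i where ci: "c < K" "i < len c" "j = pos c i" using j by (rule site_cases)
    then show ?thesis
      using \<sigma>_pos[of c i] enc'(2)[of c i] le_\<delta>[of c i] by simp
  qed
  then have "\<sigma> \<in> configs N \<delta>" by (auto simp: configs_def PiE_def \<sigma>_def)
  moreover have "word c \<sigma> = enc c (a c) (b c)" if "c < K" for c
    using that enc' \<sigma>_pos by (intro nth_equalityI) (auto simp: word_def)
  ultimately show ?thesis using \<sigma>_pos by blast
qed

lemma exists_encoding:
  obtains enc where
    "\<And>c x y. c < K \<Longrightarrow> x < m \<Longrightarrow> y < m \<Longrightarrow> enc c x y \<in> words (map (d c) [0..<len c])"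
    "\<And>c x y. c < K \<Longrightarrow> x < m \<Longrightarrow> y < m \<Longrightarrow> \<alpha> c (enc c x y) = x \<and> \<beta> c (enc c x y) = y"
proof -
  define enc where "enc c x y =
    inv_into (words (map (d c) [0..<len c])) (\<lambda>s. (\<alpha> c s, \<beta> c s)) (x, y)" for c x y
  have "enc c x y \<in> words (map (d c) [0..<len c]) \<and> \<alpha> c (enc c x y) = x \<and> \<beta> c (enc c x y) = y"
    if c: "c < K" and xy: "x < m" "y < m" for c x y
  proof -
    have bij: "bij_betw (\<lambda>s. (\<alpha> c s, \<beta> c s)) (words (map (d c) [0..<len c])) ({..<m} \<times> {..<m})"
      using splits[OF c] by (simp add: splits_cluster_def)
    have "(x, y) \<in> {..<m} \<times> {..<m}" using xy by simp
    with bij_betwE[OF bij_betw_inv_into[OF bij]] bij_betw_inv_into_right[OF bij] show ?thesis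
      unfolding enc_def by blast
  qed
  then show ?thesis by (intro that[of enc]) simp_all
qed

text \<open>Multiplying the site matrices of a cluster along the word that encodes
  \<open>(x, y)\<close> gives a block \<open>B c x y\<close>; on these configurations the state is
  the tensor excluded by \<open>few_flips_not_mps\<close>.\<close>

lemma few_flips_state_not_mps:
  assumes A: "\<And>j s. j < N \<Longrightarrow> s < \<delta> j \<Longrightarrow> A j s \<in> carrier_mat m m" and w: "w \<noteq> 0"
  shows "mps N m \<delta> A \<noteq> (\<lambda>\<sigma>. if supported \<sigma> \<and> flips K (type_seq \<sigma>) \<le> 1 then w else 0)"
proof
  assume eq: "mps N m \<delta> A = (\<lambda>\<sigma>. if supported \<sigma> \<and> flips K (type_seq \<sigma>) \<le> 1 then w else 0)"
  obtain enc where enc: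
    "\<And>c x y. c < K \<Longrightarrow> x < m \<Longrightarrow> y < m \<Longrightarrow> enc c x y \<in> words (map (d c) [0..<len c])"
    "\<And>c x y. c < K \<Longrightarrow> x < m \<Longrightarrow> y < m \<Longrightarrow> \<alpha> c (enc c x y) = x \<and> \<beta> c (enc c x y) = y"
    by (rule exists_encoding) blast
  define B where "B c x y = mprod m (map (\<lambda>i. A (pos c i) (enc c x y ! i)) [0..<len c])" for c x y
  show False
  proof (rule few_flips_not_mps[OF K w, of m B T])
    fix c x y assume c: "c < K" and xy: "x < m" "y < m"
    have "enc c x y ! i < \<delta> (pos c i)" if "i < len c" for i
      using enc(1)[OF c xy] le_\<delta>[OF c that] that
      by (auto simp: words_def list_all2_conv_all_nth intro: less_le_trans)
    then show "B c x y \<in> carrier_mat m m"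
      unfolding B_def using pos_less[OF c] by (intro mprod_carrier) (auto intro!: A)
  next
    fix c z assume "c < K"
    then show "\<exists>x<m. T c x = z" by (rule T_surj)
  next
    fix a b :: "nat \<Rightarrow> nat"
    assume ab: "\<And>c. c < K \<Longrightarrow> a c < m" "\<And>c. c < K \<Longrightarrow> b c < m"
    have "\<exists>\<sigma>\<in>configs N \<delta>. (\<forall>c<K. \<forall>i<len c. \<sigma> (pos c i) = enc c (a c) (b c) ! i) \<and>
        (\<forall>c<K. word c \<sigma> = enc c (a c) (b c))"
      by (rule exists_config) (simp_all add: ab enc(1))
    then obtain \<sigma> where \<sigma>: "\<sigma> \<in> configs N \<delta>"
      "\<And>c i. c < K \<Longrightarrow> i < len c \<Longrightarrow> \<sigma> (pos c i) = enc c (a c) (b c) ! i"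
      "\<And>c. c < K \<Longrightarrow> word c \<sigma> = enc c (a c) (b c)"
      by blast
    have carr: "A j (\<sigma> j) \<in> carrier_mat m m" if "j < N" for j
      using that \<sigma>(1) by (intro A) (auto simp: configs_def)
    have "mps N m \<delta> A \<sigma> = mat_trace (mprod m (map (\<lambda>j. A j (\<sigma> j)) [0..<N]))"
      using \<sigma>(1) by (simp add: mps_def mprod_def)
    also have "\<dots> = mat_trace (mprod m (map (\<lambda>c. mprod m (map (\<lambda>i. A (pos c i) (\<sigma> (pos c i))) [0..<len c])) [0..<K]))"
      using carr by (intro mat_trace_blocks)
    also have "map (\<lambda>c. mprod m (map (\<lambda>i. A (pos c i) (\<sigma> (pos c i))) [0..<len c])) [0..<K] =
        map (\<lambda>c. B c (a c) (b c)) [0..<K]"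
      using \<sigma>(2) by (auto simp: B_def intro!: arg_cong[of _ _ "mprod m"])
    finally have *: "mat_trace (mprod m (map (\<lambda>c. B c (a c) (b c)) [0..<K])) = mps N m \<delta> A \<sigma>" ..
    have K0: "Suc c mod K < K" for c using K by simp
    have "supported \<sigma> \<longleftrightarrow> (\<forall>c<K. b c = a (Suc c mod K))"
      using \<sigma>(1,3) enc ab K0 by (simp add: supported_def)
    moreover have "flips K (type_seq \<sigma>) = flips K (\<lambda>c. T c (a c))"
      unfolding flips_def using \<sigma>(3) enc ab K0
      by (intro arg_cong[of _ _ card] Collect_cong conj_cong refl) (simp add: type_seq_def)
    ultimately show "mat_trace (mprod m (map (\<lambda>c. B c (a c) (b c)) [0..<K])) =
        (if (\<forall>c<K. b c = a (Suc c mod K)) \<and> flips K (\<lambda>c. T c (a c)) \<le> 1 then w else 0)"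
      unfolding * eq by simp
  qed
qed

text \<open>This makes the limit tensor nonzero, so that it can be normalised.\<close>

lemma exists_supported: obtains \<sigma> where "supported \<sigma>" "flips K (type_seq \<sigma>) \<le> 1"
proof -
  obtain p q where "p < m" "q < m" using T_surj[of 0] K by auto
  then obtain a where a: "\<And>k. k < K \<Longrightarrow> a k < m" "flips K (\<lambda>k. T k (a k)) \<le> 1"
    using exists_few_flips[OF K, of 0 p m q T] T_surj K by (metis zero_less_numeral less_le_trans)
  obtain enc where enc:
    "\<And>c x y. c < K \<Longrightarrow> x < m \<Longrightarrow> y < m \<Longrightarrow> enc c x y \<in> words (map (d c) [0..<len c])"
    "\<And>c x y. c < K \<Longrightarrow> x < m \<Longrightarrow> y < m \<Longrightarrow> \<alpha> c (enc c x y) = x \<and> \<beta> c (enc c x y) = y"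
    by (rule exists_encoding) blast
  have K0: "Suc c mod K < K" for c using K by simp
  have "\<exists>\<sigma>\<in>configs N \<delta>. (\<forall>c<K. \<forall>i<len c. \<sigma> (pos c i) = enc c (a c) (a (Suc c mod K)) ! i) \<and>
      (\<forall>c<K. word c \<sigma> = enc c (a c) (a (Suc c mod K)))"
    by (rule exists_config) (simp_all add: a(1) enc(1) K0)
  then obtain \<sigma> where \<sigma>: "\<sigma> \<in> configs N \<delta>" "\<And>c. c < K \<Longrightarrow> word c \<sigma> = enc c (a c) (a (Suc c mod K))"
    by blast
  have "supported \<sigma>" using \<sigma> enc a(1) K0 by (simp add: supported_def)
  moreover have "flips K (type_seq \<sigma>) = flips K (\<lambda>c. T c (a c))"
    unfolding flips_def using \<sigma>(2) enc a(1) K0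
    by (intro arg_cong[of _ _ card] Collect_cong conj_cong refl) (simp add: type_seq_def)
  ultimately show ?thesis using a(2) that by simp
qed

text \<open>The weighted states, normalised, form a sequence in the set; its limit is the normalised
  state supported on at most one flip, which lies outside.\<close>

lemma not_closedin_pMPS_n: "\<not> closedin (state_topology N \<delta>) (pMPS_n N m \<delta>)"
proof
  assume closed: "closedin (state_topology N \<delta>) (pMPS_n N m \<delta>)"
  \<comment> \<open>The exponent of \<open>\<epsilon>\<close> is 0 iff there is at most one flip.
    Those coefficients are constantly 1, and all others tend to 0.\<close>
  define e where "e n = (if odd n then n - 1 else n)" for n :: nat
  have e0: "e n = 0 \<longleftrightarrow> n \<le> 1" for n
    by (cases n) (auto simp: e_def odd_pos)
  define \<epsilon> where "\<epsilon> k = complex_of_real (inverse (real (Suc k)))" for k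
  have \<epsilon>: "\<epsilon> \<longlonglongrightarrow> 0"
    unfolding \<epsilon>_def using tendsto_of_real[OF LIMSEQ_inverse_real_of_nat, where 'a = complex] by simp
  have \<epsilon>_nz: "\<epsilon> k \<noteq> 0" for k by (simp add: \<epsilon>_def del: of_nat_Suc)
  define \<phi> where "\<phi> k \<sigma> = (if supported \<sigma> then \<epsilon> k ^ e (flips K (type_seq \<sigma>)) else 0)" for k \<sigma>
  define \<phi>0 where "\<phi>0 \<sigma> = (if supported \<sigma> \<and> flips K (type_seq \<sigma>) \<le> 1 then 1 else 0 :: complex)" for \<sigma>
  have lim: "(\<lambda>k. \<phi> k \<sigma>) \<longlonglongrightarrow> \<phi>0 \<sigma>" for \<sigma>
  proof (cases "supported \<sigma>")
    case True
    have "(\<lambda>k. \<epsilon> k ^ e (flips K (type_seq \<sigma>))) \<longlonglongrightarrow> 0 ^ e (flips K (type_seq \<sigma>))"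
      using \<epsilon> by (rule tendsto_power)
    then show ?thesis
      using True e0[of "flips K (type_seq \<sigma>)"]
      by (cases "flips K (type_seq \<sigma>) \<le> 1") (simp_all add: \<phi>_def \<phi>0_def power_0_left)
  qed (simp add: \<phi>_def \<phi>0_def)
  \<comment> \<open>\<open>\<sigma>0\<close> has coefficient 1 in every \<open>\<phi> k\<close> and
    in the limit, so all norms involved are positive.\<close>
  obtain \<sigma>0 where \<sigma>0: "supported \<sigma>0" "flips K (type_seq \<sigma>0) \<le> 1" by (rule exists_supported)
  have norm_pos: "0 < state_norm N \<delta> \<psi>" if "\<psi> \<sigma>0 = 1" for \<psi>
  proof -
    have "state_norm N \<delta> \<psi> \<noteq> 0"
      using that \<sigma>0 by (auto simp: state_norm_L2_set L2_set_eq_0_iff finite_configs supported_def intro!: bexI[of _ \<sigma>0])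
    moreover have "0 \<le> state_norm N \<delta> \<psi>" by (simp add: state_norm_def sum_nonneg)
    ultimately show ?thesis by simp
  qed
  have norm_scale: "state_norm N \<delta> (\<lambda>\<sigma>. \<psi> \<sigma> / of_real c) = state_norm N \<delta> \<psi> / c" if "0 < c" for \<psi> c
    using that by (simp add: state_norm_def norm_divide power_divide real_sqrt_divide flip: sum_divide_distrib)
  define n where "n k = state_norm N \<delta> (\<phi> k)" for k
  define n0 where "n0 = state_norm N \<delta> \<phi>0"
  have n: "0 < n k" for k
    unfolding n_def using \<sigma>0 e0[of "flips K (type_seq \<sigma>0)"] by (intro norm_pos) (simp add: \<phi>_def)
  have n0: "0 < n0"
    unfolding n0_def using \<sigma>0 by (intro norm_pos) (simp add: \<phi>0_def)
  have lim_n: "n \<longlonglongrightarrow> n0"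
    unfolding n_def n0_def state_norm_def by (intro tendsto_intros lim)
  define \<psi> where "\<psi> k \<sigma> = \<phi> k \<sigma> / of_real (n k)" for k \<sigma>
  define \<psi>0 where "\<psi>0 \<sigma> = \<phi>0 \<sigma> / of_real n0" for \<sigma>
  have lim_\<psi>: "(\<lambda>k. \<psi> k \<sigma>) \<longlonglongrightarrow> \<psi>0 \<sigma>" for \<sigma>
    unfolding \<psi>_def \<psi>0_def using n0 by (intro tendsto_intros lim lim_n) auto
  have "(\<lambda>k. state_dist N \<delta> (\<psi> k) \<psi>0) \<longlonglongrightarrow> sqrt (\<Sum>\<sigma>\<in>configs N \<delta>. (cmod (\<psi>0 \<sigma> - \<psi>0 \<sigma>))\<^sup>2)"
    unfolding state_dist_def state_norm_def by (intro tendsto_intros lim_\<psi>)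
  then have dist: "(\<lambda>k. state_dist N \<delta> (\<psi> k) \<psi>0) \<longlonglongrightarrow> 0" by simp
  have mem: "\<psi> k \<in> pMPS_n N m \<delta>" for k
  proof -
    \<comment> \<open>The normalising factor enters as \<open>\<kappa>\<close>, hence through the
      matrices of cluster 0.\<close>
    obtain A where A: "\<And>j s. j < N \<Longrightarrow> A j s \<in> carrier_mat m m"
      "mps N m \<delta> A = (\<lambda>\<sigma>. if supported \<sigma>
        then \<Prod>c<K. flip_weight (\<epsilon> k) (1 / of_real (n k)) c (type_seq \<sigma> c) (type_seq \<sigma> (Suc c mod K)) else 0)"
      using weighted_state_is_mps[of "flip_weight (\<epsilon> k) (1 / of_real (n k))"] by blast
    have "mps N m \<delta> A = \<psi> k"
      using K \<epsilon>_nz[of k] by (auto simp: A(2) \<psi>_def \<phi>_def e_def prod_flip_weight fun_eq_iff)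
    moreover have "state_norm N \<delta> (\<psi> k) = 1"
      unfolding \<psi>_def using n[of k] by (subst norm_scale) (simp_all add: n_def)
    ultimately show ?thesis using A(1) by (auto simp: pMPS_n_def intro!: exI[of _ A])
  qed
  interpret M: Metric_space "state_space N \<delta>" "state_dist N \<delta>" by (rule Metric_space_state)
  have "\<psi>0 \<in> state_space N \<delta>" by (auto simp: state_space_def \<psi>0_def \<phi>0_def supported_def)
  moreover have "\<psi> k \<in> state_space N \<delta>" for k using mem pMPS_n_subset by blast
  ultimately have "limitin M.mtopology \<psi> \<psi>0 sequentially"
    using dist by (simp add: M.limitin_metric_dist_null)
  then have "\<psi>0 \<in> pMPS_n N m \<delta>"
    using closed mem unfolding state_topology_def M.metric_closedin_iff_sequentially_closed by blast
  then obtain A where A: "\<forall>j<N. \<forall>s<\<delta> j. A j s \<in> carrier_mat m m" "\<psi>0 = mps N m \<delta> A"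
    by (auto simp: pMPS_n_def)
  have "\<psi>0 = (\<lambda>\<sigma>. if supported \<sigma> \<and> flips K (type_seq \<sigma>) \<le> 1 then 1 / of_real n0 else 0)"
    by (auto simp: \<psi>0_def \<phi>0_def)
  then show False
    using few_flips_state_not_mps[of A "1 / of_real n0"] A n0 by auto
qed

end

section \<open>Both statements as instances of the clustered ring\<close>

theorem proposition6:
  shows
    "(\<forall>(l::nat) (d::nat) (dt::nat) (m::nat) (N::nat).
        1 \<le> l \<and> 1 < d \<and> d \<le> dt \<and> real m = real d powr (real l / 2) \<and> l dvd N \<and> 3 * l \<le> N
        \<longrightarrow> \<not> closedin (state_topology N (\<lambda>_. dt)) (pMPS_n N m (\<lambda>_. dt)))
     \<and>
     (\<forall>(m::nat) (N::nat) (\<delta> :: nat \<Rightarrow> nat)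
        (K::nat) (len :: nat \<Rightarrow> nat) (r::nat) (dt :: nat \<Rightarrow> nat \<Rightarrow> nat) (d :: nat \<Rightarrow> nat \<Rightarrow> nat).
        1 < m \<and> 3 \<le> K \<and> (\<forall>c<K. 1 \<le> len c) \<and> N = (\<Sum>c<K. len c) \<and>
        (\<forall>c<K. \<forall>i<len c. \<delta> ((r + (\<Sum>b<c. len b) + i) mod N) = dt c i) \<and>
        (\<forall>c<K. \<forall>i<len c. 0 < d c i \<and> d c i \<le> dt c i) \<and>
        (\<forall>c<K. m\<^sup>2 = (\<Prod>i<len c. d c i))
        \<longrightarrow> \<not> closedin (state_topology N \<delta>) (pMPS_n N m \<delta>))"
proof -
  have ii: "\<not> closedin (state_topology N \<delta>) (pMPS_n N m \<delta>)"
    if m: "1 < m" and K: "3 \<le> K" and len: "\<forall>c<K. 1 \<le> len c" and N: "N = (\<Sum>c<K. len c)"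
      and le: "\<forall>c<K. \<forall>i<len c. d c i \<le> \<delta> ((r + (\<Sum>b<c. len b) + i) mod N)"
      and sq: "\<forall>c<K. m\<^sup>2 = (\<Prod>i<len c. d c i)"
    for m N K r :: nat and \<delta> len :: "nat \<Rightarrow> nat" and d :: "nat \<Rightarrow> nat \<Rightarrow> nat"
  proof -
    have "\<forall>c. \<exists>\<alpha> \<beta> Q. c < K \<longrightarrow> splits_cluster m (map (d c) [0..<len c]) \<alpha> \<beta> Q"
    proof
      fix c
      have "prod_list (map (d c) [0..<len c]) = m\<^sup>2" if "c < K"
        using that sq by (simp add: prod.distinct_set_conv_list[symmetric] atLeast0LessThan)
      then show "\<exists>\<alpha> \<beta> Q. c < K \<longrightarrow> splits_cluster m (map (d c) [0..<len c]) \<alpha> \<beta> Q"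
        using exists_splits_cluster[OF _ m] by blast
    qed
    then obtain \<alpha> \<beta> Q where
      splits: "\<And>c. c < K \<Longrightarrow> splits_cluster m (map (d c) [0..<len c]) (\<alpha> c) (\<beta> c) (Q c)"
      by metis
    have "0 < len 0" "len 0 \<le> N"
      using K len[rule_format, of 0] member_le_sum[of 0 "{..<K}" len] by (auto simp: N)
    then have "0 < N" by simp
    then interpret clustered_ring m N K r len \<delta> d \<alpha> \<beta> Q "\<lambda>c i. (r + (\<Sum>b<c. len b) + i) mod N"
      using K N le splits by unfold_locales auto
    show ?thesis by (rule not_closedin_pMPS_n)
  qed
  \<comment> \<open>A special case of \<open>ii\<close>: \<open>N div l\<close> clusters of length
    \<open>l\<close>, starting at site 0, with \<open>d\<close> labels in use at every site.\<close>
  have i: "\<not> closedin (state_topology N (\<lambda>_. dt)) (pMPS_n N m (\<lambda>_. dt))"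
    if "1 \<le> l" "1 < d" "d \<le> dt" "real m = real d powr (real l / 2)" "l dvd N" "3 * l \<le> N"
    for l d dt m N :: nat
  proof -
    obtain K where N: "N = K * l" using \<open>l dvd N\<close> by (metis dvdE mult.commute)
    \<comment> \<open>Squaring turns the real power into the integer identity
      \<open>m\<^sup>2 = d ^ l\<close>, also for odd \<open>l\<close>.\<close>
    have "(real m)\<^sup>2 = real d powr real l"
      using that by (simp add: power2_eq_square flip: powr_add)
    also have "\<dots> = real (d ^ l)" using that by (simp add: powr_realpow)
    finally have m: "m\<^sup>2 = d ^ l" by (simp flip: of_nat_power)
    have "1 < d ^ l" using that by (intro one_less_power) auto
    then have "1 < m\<^sup>2" by (simp only: m)
    then have "1 < m" by (rule contrapos_pp) (auto simp: not_less le_Suc_eq)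
    moreover have "3 \<le> K" using that N by simp
    ultimately show ?thesis
      using ii[of m K "\<lambda>_. l" N "\<lambda>_ _. d" "\<lambda>_. dt" 0] that N m by simp
  qed
  show ?thesis
  proof (intro conjI allI impI)
    fix l d dt m N :: nat
    assume "1 \<le> l \<and> 1 < d \<and> d \<le> dt \<and> real m = real d powr (real l / 2) \<and> l dvd N \<and> 3 * l \<le> N"
    then show "\<not> closedin (state_topology N (\<lambda>_. dt)) (pMPS_n N m (\<lambda>_. dt))"
      using i by blast
  next
    fix m N K r :: nat and \<delta> len :: "nat \<Rightarrow> nat" and dt d :: "nat \<Rightarrow> nat \<Rightarrow> nat"
    assume "1 < m \<and> 3 \<le> K \<and> (\<forall>c<K. 1 \<le> len c) \<and> N = (\<Sum>c<K. len c) \<and>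
      (\<forall>c<K. \<forall>i<len c. \<delta> ((r + (\<Sum>b<c. len b) + i) mod N) = dt c i) \<and>
      (\<forall>c<K. \<forall>i<len c. 0 < d c i \<and> d c i \<le> dt c i) \<and>
      (\<forall>c<K. m\<^sup>2 = (\<Prod>i<len c. d c i))"
    then show "\<not> closedin (state_topology N \<delta>) (pMPS_n N m \<delta>)"
      by (elim conjE) (rule ii[of m K len N d \<delta> r], simp_all)
  qed
qed

end
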